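(* Each integer $n>1$ can be written as $$\frac{w(5w+1)}2+\frac{x(5x+1)}2+\frac{y(5y+1)}2+\frac{z(5z+1)}2$$ with $w,x,y,z\in\mathbb{Z}$. Moreover, any integer $n\geq 776$ can be written as $$\frac{w(5w+1)}2+\frac{x(5x+1)}2+\frac{y(5y+1)}2+\frac{z(5z+1)}2$$ with $w,x,y,z\in\mathbb{N}$, and any integer $n\geq 884$ can be written as $$\frac{w(5w-1)}2+\frac{x(5x-1)}2+\frac{y(5y-1)}2+\frac{z(5z-1)}2$$ with $w,x,y,z\in\mathbb{N}$.
   Context: $\mathbb{N}=\{0,1,2,\ldots\}$. *)

theory Defs
  imports Main
begin

text \<open>The integer divisions by 2 in the main theorem are exact:\<close>

lemma even_mult_5_plus_1: "even (w * (5 * w + 1))" for w :: int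
  by simp

lemma even_mult_5_minus_1: "even (w * (5 * w - 1))" for w :: int
  by simp

end

theory Submission
  imports Defs "HOL-Number_Theory.Number_Theory" "HOL-Computational_Algebra.Squarefree"
    "HOL-Analysis.Infinite_Sum"
begin

text \<open>
  Writing \<open>2n = 5a \<plusminus> b\<close>, one needs natural numbers with sum of squares \<open>a\<close> and sum \<open>b\<close>.
  By Cauchy's lemma these exist if \<open>a\<close>, \<open>b\<close> are odd, \<open>b\<^sup>2 < 4a\<close> and \<open>3a < b\<^sup>2 + 2b + 4\<close>, because
  \<open>4a - b\<^sup>2\<close> is \<open>3\<close> modulo \<open>8\<close> and hence a sum of three odd squares. For large \<open>n\<close> the admissible
  range of \<open>b\<close> meets every residue class modulo \<open>10\<close>; the remaining \<open>n\<close> are computed.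

  The three squares theorem for squarefree \<open>n\<close> congruent to \<open>3\<close> modulo \<open>8\<close> is proved without
  Dirichlet's theorem. Instead of a prime it suffices to find \<open>q\<close> coprime to \<open>n\<close> with
  \<open>(q/p) = (-2/p)\<close> for all \<open>p | n\<close> and \<open>w(q) > 0\<close>, where \<open>w(q)\<close> is the sum of the Jacobi symbols
  \<open>(d/n)\<close> over the divisors \<open>d\<close> of \<open>q\<close>. If there were none, then
  \<open>\<Sum> w(q) \<Prod>\<^sub>p (1 + (-2/p)(q/p)) t\<^sup>q = 0\<close>. Expanding the product gives a sum of double series
  \<open>\<Sum> \<chi>\<^sub>1(d) \<chi>\<^sub>2(e) t\<^bsup>de\<^esup>\<close>; those with both characters nontrivial stay bounded as \<open>t \<rightarrow> 1\<close>, while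
  the other two are equal and at least \<open>\<Sum> t\<^bsup>(1 + kn)\<^sup>2\<^esup>\<close>, which is unbounded.
  For the squarefree part \<open>q\<^sub>0\<close> of \<open>q\<close>, \<open>-n\<close> is a square modulo \<open>2q\<^sub>0\<close> and \<open>-2q\<^sub>0\<close> is a square
  modulo \<open>n\<close>, so \<open>n\<close> is represented by a positive ternary form of determinant 1, which is
  equivalent to a sum of three squares.
\<close>

section \<open>Reduction of ternary forms\<close>

lemma balanced_shift:
  fixes a f :: int
  assumes "a > 0"
  obtains k where "2 * \<bar>f + a * k\<bar> \<le> a"
proof
  define k where "k = - ((2 * f + a) div (2 * a))"
  have "2 * f + a = 2 * a * ((2 * f + a) div (2 * a)) + (2 * f + a) mod (2 * a)"
    by simp
  then have "2 * (f + a * k) + a = (2 * f + a) mod (2 * a)"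
    by (simp add: k_def algebra_simps)
  moreover have "0 \<le> (2 * f + a) mod (2 * a)" "(2 * f + a) mod (2 * a) < 2 * a"
    using assms by auto
  ultimately show "2 * \<bar>f + a * k\<bar> \<le> a" by linarith
qed

text \<open>Gauss reduction. A shift brings the middle coefficient to at most \<open>B / 2\<close>
  in absolute value. If the last coefficient is then below \<open>B\<close>, swapping the variables
  descends; otherwise \<open>B * B \<le> B * C'\<close> and the determinant equation give
  \<open>3 * B\<^sup>2 \<le> 4 * \<Delta>\<close>. The pair \<open>p\<close>, \<open>r\<close> is
  the first column of the unimodular substitution, so the bounded value is the leading coefficient
  of an equivalent form.\<close>

lemma binary_form_reduction:
  fixes B D C \<Delta> :: int
  assumes "B > 0" "B * C - D\<^sup>2 = \<Delta>" "\<Delta> > 0"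
  shows "\<exists>p q r s. p * s - q * r = 1 \<and> B * p\<^sup>2 + 2 * D * p * r + C * r\<^sup>2 > 0
           \<and> 3 * (B * p\<^sup>2 + 2 * D * p * r + C * r\<^sup>2)\<^sup>2 \<le> 4 * \<Delta>"
  using assms
proof (induction "nat B" arbitrary: B D C rule: less_induct)
  case less
  obtain k where k: "2 * \<bar>D + B * k\<bar> \<le> B"
    using balanced_shift less.prems(1) by blast
  define D' C' where "D' = D + B * k" and "C' = C + 2 * D * k + B * k\<^sup>2"
  have eq: "B * C' - D'\<^sup>2 = \<Delta>"
    using less.prems(2) by (simp add: D'_def C'_def algebra_simps power2_eq_square)
  show ?case
  proof (cases "C' < B")
    case True
    have "B * C' > 0" using eq less.prems(3) zero_le_power2[of D'] by linarith
    then have "C' > 0" using less.prems(1) by (simp add: zero_less_mult_iff)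
    have "nat C' < nat B" using True \<open>C' > 0\<close> by linarith
    from less.hyps[OF this \<open>C' > 0\<close>, of B "- D'"] eq less.prems(3)
    obtain p q r s where *: "p * s - q * r = 1"
      "C' * p\<^sup>2 + 2 * (-D') * p * r + B * r\<^sup>2 > 0"
      "3 * (C' * p\<^sup>2 + 2 * (-D') * p * r + B * r\<^sup>2)\<^sup>2 \<le> 4 * \<Delta>"
      by (auto simp: algebra_simps)
    \<comment> \<open>The column \<open>(p, r)\<close> found for the swapped form becomes
      \<open>(k * p - r, p)\<close> when the swap and the shift are undone.\<close>
    have "B * (k * p - r)\<^sup>2 + 2 * D * (k * p - r) * p + C * p\<^sup>2
        = C' * p\<^sup>2 + 2 * (-D') * p * r + B * r\<^sup>2"
      by (simp add: D'_def C'_def algebra_simps power2_eq_square)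
    moreover have "(k * p - r) * q - (k * q - s) * p = 1"
      using *(1) by (simp add: algebra_simps)
    ultimately show ?thesis using *(2,3) by metis
  next
    case False
    have "B * B \<le> B * C'" using False less.prems(1) by simp
    moreover have "(2 * \<bar>D'\<bar>)\<^sup>2 \<le> B\<^sup>2" using k unfolding D'_def by (intro power_mono) auto
    ultimately have "3 * B\<^sup>2 \<le> 4 * \<Delta>"
      using eq by (simp add: power2_eq_square)
    then show ?thesis using less.prems(1)
      by (intro exI[of _ 1] exI[of _ 0] exI[of _ 0] exI[of _ 1]) simp
  qed
qed

text \<open>For determinant 1 the reduction bound forces the leading coefficient \<open>E\<close> to
  be 1; completing the square then leaves the square of the other variable.\<close>

lemma binary_form_sum_two_squares:
  fixes B D C y z :: int
  assumes "B > 0" "B * C - D\<^sup>2 = 1"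
  shows "\<exists>v w. B * y\<^sup>2 + 2 * D * y * z + C * z\<^sup>2 = v\<^sup>2 + w\<^sup>2"
proof -
  obtain p q r s where *: "p * s - q * r = 1" "B * p\<^sup>2 + 2 * D * p * r + C * r\<^sup>2 > 0"
      "3 * (B * p\<^sup>2 + 2 * D * p * r + C * r\<^sup>2)\<^sup>2 \<le> 4"
    using binary_form_reduction[OF assms] by auto
  define E where "E = B * p\<^sup>2 + 2 * D * p * r + C * r\<^sup>2"
  have "E < 2"
  proof (rule ccontr)
    assume "\<not> E < 2"
    then have "2\<^sup>2 \<le> E\<^sup>2" by (intro power_mono) auto
    then show False using *(3) unfolding E_def by simp
  qed
  then have E: "E = 1" using *(2) unfolding E_def by simp
  define D' C' where "D' = B * p * q + D * (p * s + q * r) + C * r * s"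
    and "C' = B * q\<^sup>2 + 2 * D * q * s + C * s\<^sup>2"
  have "E * C' - D'\<^sup>2 = (B * C - D\<^sup>2) * (p * s - q * r)\<^sup>2"
    by (simp add: E_def D'_def C'_def algebra_simps power2_eq_square)
  then have C': "C' = 1 + D'\<^sup>2" using *(1) assms E by simp
  define y' z' where "y' = s * y - q * z" and "z' = p * z - r * y"
  have "p * y' + q * z' = (p * s - q * r) * y" "r * y' + s * z' = (p * s - q * r) * z"
    by (simp_all add: y'_def z'_def algebra_simps)
  then have yz: "y = p * y' + q * z'" "z = r * y' + s * z'" using *(1) by simp_all
  have "B * y\<^sup>2 + 2 * D * y * z + C * z\<^sup>2 = E * y'\<^sup>2 + 2 * D' * y' * z' + C' * z'\<^sup>2"
    unfolding yz E_def D'_def C'_def by (simp add: algebra_simps power2_eq_square)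
  also have "\<dots> = (y' + D' * z')\<^sup>2 + z'\<^sup>2"
    unfolding E C' by (simp add: algebra_simps power2_eq_square)
  finally show ?thesis by blast
qed

text \<open>The symmetric matrix of the form has rows \<open>(a, f, e)\<close>,
  \<open>(f, b, d)\<close>, \<open>(e, d, c)\<close>; \<open>tdet\<close> is its
  determinant.\<close>

definition tform :: "int \<Rightarrow> int \<Rightarrow> int \<Rightarrow> int \<Rightarrow> int \<Rightarrow> int \<Rightarrow> int \<Rightarrow> int \<Rightarrow> int \<Rightarrow> int" where
  "tform a b c d e f x y z
     = a * x\<^sup>2 + b * y\<^sup>2 + c * z\<^sup>2 + 2 * d * y * z + 2 * e * x * z + 2 * f * x * y"

definition tdet :: "int \<Rightarrow> int \<Rightarrow> int \<Rightarrow> int \<Rightarrow> int \<Rightarrow> int \<Rightarrow> int" where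
  "tdet a b c d e f = a * b * c + 2 * d * e * f - a * d\<^sup>2 - b * e\<^sup>2 - c * f\<^sup>2"

text \<open>Completing the square, \<open>a\<close> times the form is
  \<open>(a * x + f * y + e * z)\<^sup>2\<close> plus a binary form in \<open>y\<close>,
  \<open>z\<close> of determinant \<open>a\<close>. Reducing that binary form gives
  \<open>3 * B'\<^sup>2 \<le> 4 * a\<close>, and a shift of \<open>x\<close> makes \<open>f'\<close>
  small. Either \<open>b' < a\<close> and a swap descends, or
  \<open>3 * a\<^sup>2 \<le> 4 * B'\<close>; both bounds together give
  \<open>27 * a ^ 3 \<le> 64\<close>, so \<open>a = 1\<close>.\<close>

lemma unimodular_ternary_form_sum_three_squares:
  assumes "a > 0" "a * b - f\<^sup>2 > 0" "tdet a b c d e f = 1"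
  shows "\<exists>u v w. tform a b c d e f x y z = u\<^sup>2 + v\<^sup>2 + w\<^sup>2"
  using assms
proof (induction "nat a" arbitrary: a b c d e f x y z rule: less_induct)
  case less
  define B D C where "B = a * b - f\<^sup>2" and "D = a * d - e * f" and "C = a * c - e\<^sup>2"
  have "B * C - D\<^sup>2 = a * tdet a b c d e f"
    by (simp add: B_def C_def D_def tdet_def algebra_simps power2_eq_square)
  then have BCD: "B * C - D\<^sup>2 = a" using less.prems by simp
  have "B > 0" using less.prems by (simp add: B_def)
  from binary_form_reduction[OF this BCD less.prems(1)]
  obtain p q r s where *: "p * s - q * r = 1" "B * p\<^sup>2 + 2 * D * p * r + C * r\<^sup>2 > 0"
      "3 * (B * p\<^sup>2 + 2 * D * p * r + C * r\<^sup>2)\<^sup>2 \<le> 4 * a" by auto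
  define B' where "B' = B * p\<^sup>2 + 2 * D * p * r + C * r\<^sup>2"
  obtain k where k: "2 * \<bar>f * p + e * r + a * k\<bar> \<le> a"
    using balanced_shift less.prems(1) by blast
  \<comment> \<open>Coefficients after \<open>y = p * y' + q * z'\<close>,
    \<open>z = r * y' + s * z'\<close> and \<open>x = x' + k * y'\<close>; the leading coefficient
    \<open>a\<close> is unchanged.\<close>
  define f' e' b' c' d' where
    "f' = f * p + e * r + a * k" and
    "e' = f * q + e * s" and
    "b' = b * p\<^sup>2 + 2 * d * p * r + c * r\<^sup>2 + 2 * k * (f * p + e * r) + a * k\<^sup>2" and
    "c' = b * q\<^sup>2 + 2 * d * q * s + c * s\<^sup>2" and
    "d' = b * p * q + d * (p * s + q * r) + c * r * s + k * (f * q + e * s)"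
  note defs = b'_def c'_def d'_def e'_def f'_def
  define y' z' x' where "y' = s * y - q * z" and "z' = p * z - r * y" and "x' = x - k * y'"
  have "p * y' + q * z' = (p * s - q * r) * y" "r * y' + s * z' = (p * s - q * r) * z"
    by (simp_all add: y'_def z'_def algebra_simps)
  then have xyz: "x = x' + k * y'" "y = p * y' + q * z'" "z = r * y' + s * z'"
    using *(1) by (simp_all add: x'_def)
  have form: "tform a b c d e f x y z = tform a b' c' d' e' f' x' y' z'"
    unfolding xyz tform_def defs by (simp add: algebra_simps power2_eq_square)
  have "tdet a b' c' d' e' f' = tdet a b c d e f * (p * s - q * r)\<^sup>2"
    unfolding tdet_def defs by (simp add: algebra_simps power2_eq_square)
  then have det': "tdet a b' c' d' e' f' = 1" using *(1) less.prems(3) by simp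
  have B': "a * b' - f'\<^sup>2 = B'"
    unfolding B'_def B_def C_def D_def defs by (simp add: algebra_simps power2_eq_square)
  have "B' > 0" using *(2) by (simp add: B'_def)
  have "a * b' > 0" using B' \<open>B' > 0\<close> zero_le_power2[of f'] by linarith
  then have "b' > 0" using less.prems(1) by (simp add: zero_less_mult_iff)
  show ?case
  proof (cases "b' < a")
    case True
    have "\<exists>u v w. tform b' a c' e' d' f' y' x' z' = u\<^sup>2 + v\<^sup>2 + w\<^sup>2"
    proof (rule less.hyps)
      show "nat b' < nat a" using True \<open>b' > 0\<close> by linarith
      show "b' * a - f'\<^sup>2 > 0" using B' \<open>B' > 0\<close> by (simp add: mult.commute)
      show "tdet b' a c' e' d' f' = 1" using det' by (simp add: tdet_def algebra_simps)
    qed fact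
    moreover have "tform b' a c' e' d' f' y' x' z' = tform a b' c' d' e' f' x' y' z'"
      by (simp add: tform_def algebra_simps)
    ultimately show ?thesis using form by simp
  next
    case False
    have "a * a \<le> a * b'" using False less.prems(1) by simp
    moreover have "(2 * \<bar>f'\<bar>)\<^sup>2 \<le> a\<^sup>2" using k unfolding f'_def by (intro power_mono) auto
    ultimately have "3 * a\<^sup>2 \<le> 4 * B'" using B' by (simp add: power2_eq_square)
    then have "(3 * a\<^sup>2)\<^sup>2 \<le> (4 * B')\<^sup>2" by (intro power_mono) auto
    moreover have "3 * B'\<^sup>2 \<le> 4 * a" using *(3) by (simp add: B'_def)
    ultimately have "a * (27 * a ^ 3) \<le> a * 64" by (simp add: power2_eq_square power3_eq_cube)
    then have a3: "27 * a ^ 3 \<le> 64" using less.prems(1) by simp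
    have "a = 1"
    proof (rule ccontr)
      assume "a \<noteq> 1"
      then have "2 ^ 3 \<le> a ^ 3" using less.prems(1) by (intro power_mono) auto
      then show False using a3 by simp
    qed
    \<comment> \<open>For \<open>a = 1\<close> the square can be completed over the integers in the
      original form, leaving a binary form of determinant 1.\<close>
    have "\<exists>v w. B * y\<^sup>2 + 2 * D * y * z + C * z\<^sup>2 = v\<^sup>2 + w\<^sup>2"
      using binary_form_sum_two_squares \<open>B > 0\<close> BCD \<open>a = 1\<close> by simp
    then obtain v w where "B * y\<^sup>2 + 2 * D * y * z + C * z\<^sup>2 = v\<^sup>2 + w\<^sup>2" by blast
    then have "tform a b c d e f x y z = (x + f * y + e * z)\<^sup>2 + v\<^sup>2 + w\<^sup>2"
      unfolding tform_def B_def C_def D_def \<open>a = 1\<close>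
      by (simp add: algebra_simps power2_eq_square)
    then show ?thesis by blast
  qed
qed

text \<open>The matrix with rows \<open>(Q, t, 0)\<close>, \<open>(t, r, v)\<close>, \<open>(0, v, w)\<close> has determinant 1, and \<open>n\<close> is a
  diagonal entry of its adjugate.\<close>

lemma sum_three_squares_criterion:
  fixes n Q t r v w :: int
  assumes "n > 0" "Q > 0" "Q * r - t\<^sup>2 = n" "w * n = 1 + Q * v\<^sup>2"
  shows "\<exists>x y z. n = x\<^sup>2 + y\<^sup>2 + z\<^sup>2"
proof -
  have "n * (Q * w) - (- (Q * v))\<^sup>2 = Q * (w * n - Q * v\<^sup>2)"
    by (simp add: algebra_simps power2_eq_square)
  then have "n * (Q * w) - (- (Q * v))\<^sup>2 > 0" using assms by simp
  \<comment> \<open>The determinant of an adjugate of size 3 is the square of the determinant. The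
    cofactor \<open>n\<close> is placed first, so the form takes the value \<open>n\<close> at
    \<open>(1, 0, 0)\<close>.\<close>
  moreover have "tdet n (Q * w) (r * w - v\<^sup>2) (- (t * w)) (t * v) (- (Q * v))
      = (w * (Q * r - t\<^sup>2) - Q * v\<^sup>2)\<^sup>2"
    unfolding tdet_def assms(3)[symmetric] by (simp add: algebra_simps power2_eq_square)
  ultimately have "\<exists>x y z. tform n (Q * w) (r * w - v\<^sup>2) (- (t * w)) (t * v) (- (Q * v)) 1 0 0
      = x\<^sup>2 + y\<^sup>2 + z\<^sup>2"
    using assms by (intro unimodular_ternary_form_sum_three_squares) auto
  then show ?thesis by (simp add: tform_def)
qed

section \<open>Lambert series with periodic coefficients\<close>

text \<open>A full period contributes 0, so the partial sums are themselves periodic and take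
  finitely many values.\<close>

lemma periodic_partial_sums_bounded:
  fixes a :: "nat \<Rightarrow> real"
  assumes "n > 0" and per: "\<And>i. a (i + n) = a i" and zero: "sum a {..<n} = 0"
  shows "\<exists>M. \<forall>N. \<bar>sum a {..<N}\<bar> \<le> M"
proof -
  define A where "A = (\<lambda>N. sum a {..<N})"
  have shift: "A (k + n) = A k" for k
    by (induction k) (use zero in \<open>auto simp: A_def per\<close>)
  have shift': "A (k + m * n) = A k" for k m
  proof (induction m)
    case (Suc m)
    have "A (k + Suc m * n) = A (k + m * n + n)" by (simp add: algebra_simps)
    then show ?case using Suc shift by simp
  qed simp
  have "\<bar>A N\<bar> \<le> (\<Sum>i<n. \<bar>A i\<bar>)" for N
  proof -
    have "A N = A (N mod n)" using shift'[of "N mod n" "N div n"] by simp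
    moreover have "\<bar>A (N mod n)\<bar> \<le> (\<Sum>i<n. \<bar>A i\<bar>)"
      using \<open>n > 0\<close> by (intro member_le_sum) auto
    ultimately show ?thesis by simp
  qed
  then show ?thesis unfolding A_def by blast
qed

lemma abel_summation:
  fixes a h :: "nat \<Rightarrow> real"
  shows "(\<Sum>i<N. a i * h i)
    = sum a {..<N} * h N + (\<Sum>i<N. sum a {..<Suc i} * (h i - h (Suc i)))"
  by (induction N) (auto simp: algebra_simps)

lemma abel_summation_bound:
  fixes a h :: "nat \<Rightarrow> real"
  assumes "\<And>N. \<bar>sum a {..<N}\<bar> \<le> M"
  shows "\<bar>\<Sum>i<N. a i * h i\<bar> \<le> M * (\<bar>h N\<bar> + (\<Sum>i<N. \<bar>h i - h (Suc i)\<bar>))"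
proof -
  have M: "M \<ge> 0" using assms[of 0] by simp
  have "\<bar>\<Sum>i<N. sum a {..<Suc i} * (h i - h (Suc i))\<bar>
      \<le> (\<Sum>i<N. \<bar>sum a {..<Suc i} * (h i - h (Suc i))\<bar>)" by (rule sum_abs)
  also have "\<dots> \<le> (\<Sum>i<N. M * \<bar>h i - h (Suc i)\<bar>)"
    using assms by (intro sum_mono) (auto simp: abs_mult simp del: sum.lessThan_Suc intro!: mult_right_mono)
  also have "\<dots> = M * (\<Sum>i<N. \<bar>h i - h (Suc i)\<bar>)" by (simp add: sum_distrib_left)
  finally have "\<bar>\<Sum>i<N. sum a {..<Suc i} * (h i - h (Suc i))\<bar> \<le> M * (\<Sum>i<N. \<bar>h i - h (Suc i)\<bar>)" .
  moreover have "\<bar>sum a {..<N} * h N\<bar> \<le> M * \<bar>h N\<bar>"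
    using assms by (auto simp: abs_mult intro!: mult_right_mono)
  ultimately show ?thesis by (subst abel_summation) (simp add: distrib_left)
qed

lemma power_sum_lipschitz:
  fixes c :: "nat \<Rightarrow> real"
  assumes "0 \<le> x" "x \<le> 1" "0 \<le> y" "y \<le> 1"
  shows "\<bar>(\<Sum>k<n. c k * x ^ k) - (\<Sum>k<n. c k * y ^ k)\<bar> \<le> (\<Sum>k<n. \<bar>c k\<bar> * k) * \<bar>x - y\<bar>"
proof -
  have "\<bar>(\<Sum>k<n. c k * x ^ k) - (\<Sum>k<n. c k * y ^ k)\<bar> = \<bar>\<Sum>k<n. c k * (x ^ k - y ^ k)\<bar>"
    by (simp add: sum_subtractf algebra_simps)
  also have "\<dots> \<le> (\<Sum>k<n. \<bar>c k * (x ^ k - y ^ k)\<bar>)" by (rule sum_abs)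
  also have "\<dots> \<le> (\<Sum>k<n. \<bar>c k\<bar> * (k * \<bar>x - y\<bar>))"
  proof (rule sum_mono)
    fix k
    have "norm (x ^ k - y ^ k) \<le> k * norm (x - y)"
      by (rule norm_power_diff) (use assms in auto)
    then show "\<bar>c k * (x ^ k - y ^ k)\<bar> \<le> \<bar>c k\<bar> * (k * \<bar>x - y\<bar>)"
      by (simp add: abs_mult mult_left_mono)
  qed
  also have "\<dots> = (\<Sum>k<n. \<bar>c k\<bar> * k) * \<bar>x - y\<bar>" by (simp add: sum_distrib_right mult.assoc)
  finally show ?thesis .
qed

text \<open>The power series of a periodic sequence is a rational function; the zero mean cancels its pole
  at 1.\<close>

lemma periodic_power_series_lipschitz:
  fixes b :: "nat \<Rightarrow> real"
  assumes "n > 0" and per: "\<And>i. b (i + n) = b i" and zero: "sum b {..<n} = 0"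
    and bd: "\<And>i. \<bar>b i\<bar> \<le> 1"
  shows "\<exists>K. \<forall>x\<in>{0..<1}. \<forall>y\<in>{0..<1}.
    \<bar>(\<Sum>j. b j * x ^ Suc j) - (\<Sum>j. b j * y ^ Suc j)\<bar> \<le> K * \<bar>x - y\<bar>"
proof -
  \<comment> \<open>\<open>U\<close> is the numerator and \<open>S\<close> the denominator of the
    closed form. The series starts at exponent 1, hence \<open>c 0 = 0\<close>; the partial sum over
    a whole period vanishes, so the exponents in \<open>U\<close> stay below
    \<open>n\<close>.\<close>
  define c where "c = (\<lambda>k. if k = 0 then 0 else sum b {..<k})"
  define U where "U = (\<lambda>x::real. \<Sum>k<n. c k * x ^ k)"
  define S where "S = (\<lambda>x::real. \<Sum>k<n. 1 * x ^ k)"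
  have closed: "(\<Sum>j. b j * x ^ Suc j) = U x / S x" if x: "0 \<le> x" "x < 1" for x
  proof -
    have "summable (\<lambda>j. x ^ j)" using x by (simp add: summable_geometric)
    then have summ: "summable (\<lambda>j. b j * x ^ j)"
      by (rule summable_comparison_test'[where N = 0])
         (use bd x in \<open>auto simp: abs_mult intro!: mult_left_le_one_le\<close>)
    have per': "b (i * n + j) = b j" for i j
    proof (induction i)
      case (Suc i)
      then show ?case using per[of "i * n + j"] by (simp add: add.commute add.left_commute)
    qed simp
    have "(\<lambda>i. \<Sum>j\<in>{i * n..<i * n + n}. b j * x ^ j) sums (\<Sum>j. b j * x ^ j)"
      using sums_group[OF summable_sums[OF summ] \<open>n > 0\<close>] .
    moreover have "(\<Sum>j\<in>{i * n..<i * n + n}. b j * x ^ j) = (\<Sum>j<n. b j * x ^ j) * (x ^ n) ^ i" for i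
    proof -
      have "(\<Sum>j\<in>{i * n..<i * n + n}. b j * x ^ j) = (\<Sum>j<n. b (i * n + j) * x ^ (i * n + j))"
        using sum.shift_bounds_nat_ivl[of "\<lambda>j. b j * x ^ j" 0 "i * n" n]
        by (simp add: atLeast0LessThan add.commute)
      also have "\<dots> = (\<Sum>j<n. b j * x ^ j) * (x ^ n) ^ i"
        by (simp add: per' power_add power_mult sum_distrib_left sum_distrib_right
            mult.commute mult.left_commute flip: power_mult)
      finally show ?thesis .
    qed
    ultimately have "(\<lambda>i. (\<Sum>j<n. b j * x ^ j) * (x ^ n) ^ i) sums (\<Sum>j. b j * x ^ j)" by simp
    moreover have xn: "x ^ n < 1" using x \<open>n > 0\<close> by (simp add: power_less_one_iff)
    then have "(\<lambda>i. (\<Sum>j<n. b j * x ^ j) * (x ^ n) ^ i) sums ((\<Sum>j<n. b j * x ^ j) * (1 / (1 - x ^ n)))"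
      using x by (intro sums_mult geometric_sums) simp
    ultimately have eq: "(\<Sum>j. b j * x ^ j) = (\<Sum>j<n. b j * x ^ j) / (1 - x ^ n)"
      using sums_unique2 by fastforce
    \<comment> \<open>Abel summation with vanishing boundary term extracts the factor
      \<open>1 - x\<close>, which cancels against \<open>1 - x ^ n = (1 - x) * S x\<close>.\<close>
    have P: "(\<Sum>j<n. b j * x ^ j) = (1 - x) * (\<Sum>i<n. sum b {..<Suc i} * x ^ i)"
      by (subst abel_summation)
        (simp add: zero sum_distrib_left sum_subtractf algebra_simps del: sum.lessThan_Suc)
    have R: "x * (\<Sum>i<n. sum b {..<Suc i} * x ^ i) = U x"
    proof -
      obtain m where m: "n = Suc m" using \<open>n > 0\<close> by (cases n) auto
      have "x * (\<Sum>i<n. sum b {..<Suc i} * x ^ i) = (\<Sum>i<m. sum b {..<Suc i} * x ^ Suc i)"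
        unfolding m sum.lessThan_Suc[of "\<lambda>i. sum b {..<Suc i} * x ^ i"] zero[unfolded m]
        by (simp add: sum_distrib_left mult.left_commute del: sum.lessThan_Suc)
      also have "\<dots> = U x"
        unfolding U_def m by (subst sum.lessThan_Suc_shift) (simp add: c_def)
      finally show ?thesis .
    qed
    have S: "1 - x ^ n = (1 - x) * S x"
      unfolding S_def by (simp add: one_diff_power_eq)
    have "(\<Sum>j. b j * x ^ Suc j) = x * (\<Sum>j. b j * x ^ j)"
      using suminf_mult[OF summ, of x] by (simp add: algebra_simps)
    also have "\<dots> = x * (((1 - x) * (\<Sum>i<n. sum b {..<Suc i} * x ^ i)) / ((1 - x) * S x))"
      unfolding eq P S ..
    also have "\<dots> = (x * (\<Sum>i<n. sum b {..<Suc i} * x ^ i)) / S x"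
      using x by simp
    finally show ?thesis unfolding R .
  qed
  define C where "C = (\<Sum>k<n. \<bar>c k\<bar>)"
  define K1 where "K1 = (\<Sum>k<n. \<bar>c k\<bar> * k)"
  define K2 where "K2 = (\<Sum>k<n. \<bar>1::real\<bar> * k)"
  have S1: "S x \<ge> 1" if "0 \<le> x" for x
  proof -
    have "1 * x ^ 0 \<le> S x" unfolding S_def
      using that \<open>n > 0\<close> by (intro member_le_sum) auto
    then show ?thesis by simp
  qed
  have Sn: "S x \<le> n" if "0 \<le> x" "x < 1" for x
  proof -
    have "S x \<le> (\<Sum>k<n. 1)" unfolding S_def
      using that by (intro sum_mono) (auto intro: power_le_one)
    then show ?thesis by simp
  qed
  have UC: "\<bar>U x\<bar> \<le> C" if "0 \<le> x" "x < 1" for x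
  proof -
    have "\<bar>U x\<bar> \<le> (\<Sum>k<n. \<bar>c k * x ^ k\<bar>)" unfolding U_def by (rule sum_abs)
    also have "\<dots> \<le> C" unfolding C_def
      using that by (intro sum_mono) (auto simp: abs_mult intro!: mult_left_le power_le_one)
    finally show ?thesis .
  qed
  have "\<bar>U x / S x - U y / S y\<bar> \<le> (K1 * n + C * K2) * \<bar>x - y\<bar>"
    if "0 \<le> x" "x < 1" "0 \<le> y" "y < 1" for x y
  proof -
    have "\<bar>U x / S x - U y / S y\<bar> = \<bar>(U x - U y) * S y + U y * (S y - S x)\<bar> / (S x * S y)"
      using S1[of x] S1[of y] that by (simp add: field_simps abs_mult)
    also have "\<dots> \<le> \<bar>(U x - U y) * S y + U y * (S y - S x)\<bar> / 1"
      using mult_mono[of 1 "S x" 1 "S y"] S1[of x] S1[of y] that by (intro divide_left_mono) auto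
    also have "\<dots> \<le> \<bar>U x - U y\<bar> * S y + \<bar>U y\<bar> * \<bar>S y - S x\<bar>"
      using S1[of y] that abs_triangle_ineq[of "(U x - U y) * S y" "U y * (S y - S x)"]
      by (simp add: abs_mult)
    also have "\<dots> \<le> (K1 * \<bar>x - y\<bar>) * n + C * (K2 * \<bar>x - y\<bar>)"
    proof (intro add_mono mult_mono)
      show "\<bar>U x - U y\<bar> \<le> K1 * \<bar>x - y\<bar>"
        unfolding U_def K1_def using that by (intro power_sum_lipschitz) auto
      show "\<bar>S y - S x\<bar> \<le> K2 * \<bar>x - y\<bar>"
        unfolding S_def K2_def abs_minus_commute[of x y]
        using that by (intro power_sum_lipschitz) auto
    qed (use that S1[of y] Sn UC in \<open>auto simp: K1_def C_def intro!: mult_nonneg_nonneg sum_nonneg\<close>)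
    finally show ?thesis by (simp add: algebra_simps)
  qed
  then have "\<forall>x\<in>{0..<1}. \<forall>y\<in>{0..<1}.
    \<bar>(\<Sum>j. b j * x ^ Suc j) - (\<Sum>j. b j * y ^ Suc j)\<bar> \<le> (K1 * n + C * K2) * \<bar>x - y\<bar>"
    using closed by simp
  then show ?thesis by blast
qed

text \<open>The successors make \<open>UNIV\<close> index all pairs of positive integers
  \<open>d\<close>, \<open>e\<close>, with term \<open>f d * g e * t ^ (d * e)\<close>.\<close>

definition lambert_term :: "(nat \<Rightarrow> real) \<Rightarrow> (nat \<Rightarrow> real) \<Rightarrow> real \<Rightarrow> nat \<times> nat \<Rightarrow> real" where
  "lambert_term f g t = (\<lambda>(i, j). f (Suc i) * g (Suc j) * t ^ (Suc i * Suc j))"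

text \<open>Since \<open>(i + 1) * (j + 1) \<ge> i + j\<close>, a product of two geometric series
  dominates.\<close>

lemma lambert_term_abs_summable:
  assumes "0 < t" "t < 1" "\<And>i. \<bar>f i\<bar> \<le> 1" "\<And>i. \<bar>g i\<bar> \<le> 1"
  shows "lambert_term f g t abs_summable_on UNIV"
proof (rule abs_summable_on_comparison_test)
  have geo: "(\<lambda>j. t ^ j) summable_on (UNIV :: nat set)"
    using assms(1,2) by (intro norm_summable_imp_summable_on) (simp add: summable_geometric)
  have "(\<lambda>(i, j). t ^ i * t ^ j) abs_summable_on (UNIV \<times> UNIV :: (nat \<times> nat) set)"
    unfolding abs_summable_on_Sigma_iff
    using geo assms(1)
    by (auto simp: abs_mult infsum_cmult_right' intro!: summable_on_cmult_right summable_on_cmult_left)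
  then show "(\<lambda>(i, j). t ^ i * t ^ j) abs_summable_on (UNIV :: (nat \<times> nat) set)" by simp
  fix x :: "nat \<times> nat"
  obtain i j where x: "x = (i, j)" by force
  have "t ^ (Suc i * Suc j) \<le> t ^ (i + j)"
    using assms by (intro power_decreasing) auto
  moreover have "\<bar>f (Suc i)\<bar> * \<bar>g (Suc j)\<bar> \<le> 1 * 1"
    using assms by (intro mult_mono) auto
  ultimately have "(\<bar>f (Suc i)\<bar> * \<bar>g (Suc j)\<bar>) * t ^ (Suc i * Suc j) \<le> 1 * t ^ (i + j)"
    using assms by (intro mult_mono) auto
  then show "norm (lambert_term f g t x) \<le> norm (case x of (i, j) \<Rightarrow> t ^ i * t ^ j)"
    using assms(1) by (simp add: x lambert_term_def abs_mult power_add)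
qed

text \<open>Summing over \<open>j\<close> first leaves \<open>a i * H (t ^ Suc i)\<close> with
  \<open>H\<close> Lipschitz on \<open>{0..<1}\<close>. The points \<open>t ^ Suc i\<close>
  decrease, so the total variation of \<open>H\<close> along them is controlled by \<open>K\<close>
  uniformly in \<open>t\<close>; Abel summation against the bounded partial sums of \<open>a\<close>
  finishes.\<close>

lemma lambert_sum_bounded:
  fixes f g :: "nat \<Rightarrow> real"
  assumes "n > 0"
    and f: "\<And>i. f (i + n) = f i" "sum f {..<n} = 0" "\<And>i. \<bar>f i\<bar> \<le> 1"
    and g: "\<And>i. g (i + n) = g i" "sum g {..<n} = 0" "\<And>i. \<bar>g i\<bar> \<le> 1"
  shows "\<exists>C. \<forall>t. 0 < t \<and> t < 1 \<longrightarrow> \<bar>infsum (lambert_term f g t) UNIV\<bar> \<le> C"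
proof -
  define a b where "a = (\<lambda>i. f (Suc i))" and "b = (\<lambda>i. g (Suc i))"
  have per: "a (i + n) = a i" "b (i + n) = b i" for i
    using f(1)[of "Suc i"] g(1)[of "Suc i"] by (simp_all add: a_def b_def)
  have shift: "sum (\<lambda>i. h (Suc i)) {..<n} = sum h {..<n}" if "h (0 + n) = h 0" for h :: "nat \<Rightarrow> real"
    using that sum.lessThan_Suc_shift[of h n] by simp
  have zero: "sum a {..<n} = 0" "sum b {..<n} = 0"
    unfolding a_def b_def using f(1,2) g(1,2) shift by metis+
  obtain M where M: "\<And>N. \<bar>sum a {..<N}\<bar> \<le> M"
    using periodic_partial_sums_bounded[of n a] \<open>n > 0\<close> per(1) zero(1) by blast
  define H where "H = (\<lambda>x. \<Sum>j. b j * x ^ Suc j)"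
  obtain K where "\<forall>x\<in>{0..<1}. \<forall>y\<in>{0..<1}. \<bar>H x - H y\<bar> \<le> K * \<bar>x - y\<bar>"
    using periodic_power_series_lipschitz[of n b] \<open>n > 0\<close> per(2) zero(2) g(3)
    unfolding H_def b_def by blast
  then have K: "\<And>x y. 0 \<le> x \<Longrightarrow> x < 1 \<Longrightarrow> 0 \<le> y \<Longrightarrow> y < 1 \<Longrightarrow> \<bar>H x - H y\<bar> \<le> K * \<bar>x - y\<bar>"
    by simp
  have "H 0 = 0" by (simp add: H_def)
  have "\<bar>infsum (lambert_term f g t) UNIV\<bar> \<le> M * K" if t: "0 < t" "t < 1" for t
  proof -
    have summ: "lambert_term f g t summable_on (UNIV \<times> UNIV)"
      using abs_summable_summable[OF lambert_term_abs_summable[OF t f(3) g(3)]] by simp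
    have pw: "0 \<le> t ^ i" "t ^ Suc i < 1" for i
      using t by (auto simp: power_less_one_iff simp del: power_Suc)
    have inner: "(\<Sum>\<^sub>\<infinity>j. lambert_term f g t (i, j)) = a i * H (t ^ Suc i)" for i
    proof -
      have "summable (\<lambda>j. (t ^ Suc i) ^ Suc j)"
        using pw t by (subst summable_Suc_iff) (intro summable_geometric, simp del: power_Suc)
      then have nsumm: "summable (\<lambda>j. norm (b j * (t ^ Suc i) ^ Suc j))"
        by (rule summable_comparison_test'[where N = 0])
           (use g(3) t in \<open>auto simp: abs_mult b_def intro!: mult_left_le_one_le simp del: power_Suc\<close>)
      have "((\<lambda>j. b j * (t ^ Suc i) ^ Suc j) has_sum H (t ^ Suc i)) UNIV"
        unfolding H_def
        by (rule norm_summable_imp_has_sum[OF nsumm summable_sums[OF summable_norm_cancel[OF nsumm]]])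
      then have "((\<lambda>j. a i * (b j * (t ^ Suc i) ^ Suc j)) has_sum (a i * H (t ^ Suc i))) UNIV"
        by (rule has_sum_cmult_right)
      moreover have "a i * (b j * (t ^ Suc i) ^ Suc j) = lambert_term f g t (i, j)" for j
        unfolding lambert_term_def a_def b_def prod.case power_mult by (simp add: mult.assoc)
      ultimately show ?thesis by (simp add: infsumI)
    qed
    have "infsum (lambert_term f g t) UNIV = (\<Sum>\<^sub>\<infinity>i. a i * H (t ^ Suc i))"
      using infsum_Sigma_banach[OF summ] by (simp add: inner)
    moreover have "(\<lambda>i. a i * H (t ^ Suc i)) summable_on UNIV"
      using summable_on_Sigma_banach[of "\<lambda>i j. lambert_term f g t (i, j)" UNIV "\<lambda>_. UNIV"] summ
      by (simp add: inner)
    ultimately have "((\<lambda>i. a i * H (t ^ Suc i)) has_sum infsum (lambert_term f g t) UNIV) UNIV"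
      by simp
    then have "(\<lambda>i. a i * H (t ^ Suc i)) sums infsum (lambert_term f g t) UNIV"
      by (rule has_sum_imp_sums)
    then have "(\<lambda>N. \<bar>\<Sum>i<N. a i * H (t ^ Suc i)\<bar>) \<longlonglongrightarrow> \<bar>infsum (lambert_term f g t) UNIV\<bar>"
      unfolding sums_def by (rule tendsto_rabs)
    moreover have "\<bar>\<Sum>i<N. a i * H (t ^ Suc i)\<bar> \<le> M * K" for N
    proof -
      have "M \<ge> 0" using M[of 0] by simp
      have "0 \<le> K * t" using K[of t 0] t by (metis abs_ge_zero abs_of_pos diff_zero order.refl order.trans zero_less_one)
      then have "K \<ge> 0" using t by (simp add: zero_le_mult_iff)
      have "\<bar>H (t ^ Suc N)\<bar> \<le> K * t ^ Suc N"
        using K[of "t ^ Suc N" 0] pw[of N] pw(1)[of "Suc N"] \<open>H 0 = 0\<close> by (simp del: power_Suc)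
      moreover have "(\<Sum>i<N. \<bar>H (t ^ Suc i) - H (t ^ Suc (Suc i))\<bar>)
          \<le> (\<Sum>i<N. K * (t ^ Suc i - t ^ Suc (Suc i)))"
      proof (rule sum_mono)
        fix i
        have "t ^ Suc (Suc i) \<le> t ^ Suc i" using t by (intro power_decreasing) auto
        then show "\<bar>H (t ^ Suc i) - H (t ^ Suc (Suc i))\<bar> \<le> K * (t ^ Suc i - t ^ Suc (Suc i))"
          using K[of "t ^ Suc i" "t ^ Suc (Suc i)"] pw(1)[of "Suc i"] pw(1)[of "Suc (Suc i)"]
            pw(2)[of i] pw(2)[of "Suc i"] by (simp del: power_Suc)
      qed
      \<comment> \<open>The variation bound telescopes, and its subtracted end point absorbs the
        bound for the boundary term of Abel summation.\<close>
      moreover have "(\<Sum>i<N. K * (t ^ Suc i - t ^ Suc (Suc i))) = K * (t - t ^ Suc N)"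
        by (induction N) (auto simp: algebra_simps)
      ultimately have "\<bar>H (t ^ Suc N)\<bar> + (\<Sum>i<N. \<bar>H (t ^ Suc i) - H (t ^ Suc (Suc i))\<bar>) \<le> K * t"
        by (simp add: algebra_simps)
      also have "\<dots> \<le> K" using t \<open>K \<ge> 0\<close> by (simp add: mult_left_le)
      finally show ?thesis
        using abel_summation_bound[of a M "\<lambda>i. H (t ^ Suc i)" N] M \<open>M \<ge> 0\<close>
        by (meson mult_left_mono order_trans)
    qed
    ultimately show ?thesis by (intro LIMSEQ_le_const2) auto
  qed
  then show ?thesis by blast
qed

text \<open>Regroups the double series by the product \<open>q\<close> of the two positive indices.
  Each fibre is finite, and the fibre of \<open>q = 0\<close> is empty.\<close>

lemma lambert_sum_by_divisors:
  assumes "F summable_on (UNIV :: (nat \<times> nat) set)"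
  shows "(\<lambda>q. \<Sum>(i, j) | Suc i * Suc j = q. F (i, j) :: real) summable_on UNIV"
    and "infsum F UNIV = (\<Sum>\<^sub>\<infinity>q. \<Sum>(i, j) | Suc i * Suc j = q. F (i, j))"
proof -
  define B where "B = (\<lambda>q::nat. {(i::nat, j::nat). Suc i * Suc j = q})"
  have fin: "finite (B q)" for q
  proof (rule finite_subset)
    show "B q \<subseteq> {..q} \<times> {..q}" by (auto simp: B_def)
  qed auto
  have bij: "bij_betw snd (Sigma UNIV B) UNIV"
    by (rule bij_betwI[where g = "\<lambda>(i, j). (Suc i * Suc j, (i, j))"]) (auto simp: B_def)
  have summ: "(\<lambda>p. F (snd p)) summable_on (Sigma UNIV B)"
    using assms summable_on_reindex_bij_betw[OF bij, of F] by simp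
  have inner: "(\<Sum>\<^sub>\<infinity>p\<in>B q. F (snd (q, p))) = (\<Sum>(i, j) | Suc i * Suc j = q. F (i, j))" for q
    using fin[of q] by (simp add: B_def case_prod_unfold)
  show "(\<lambda>q. \<Sum>(i, j) | Suc i * Suc j = q. F (i, j)) summable_on UNIV"
    using summable_on_Sigma_banach[of "\<lambda>q p. F (snd (q, p))" UNIV B] summ
    unfolding inner by (simp add: case_prod_unfold)
  show "infsum F UNIV = (\<Sum>\<^sub>\<infinity>q. \<Sum>(i, j) | Suc i * Suc j = q. F (i, j))"
    using infsum_reindex_bij_betw[OF bij, of F] infsum_Sigma_banach[OF summ] unfolding inner by simp
qed

section \<open>Integers with prescribed real characters\<close>

lemma divisors_prime_power_mult:
  fixes p m :: nat
  assumes "prime p" "\<not> p dvd m"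
  shows "bij_betw (\<lambda>(i, d). p ^ i * d) ({..a} \<times> {d. d dvd m}) {d. d dvd p ^ a * m}"
proof (rule bij_betwI')
  fix x y assume xy: "x \<in> {..a} \<times> {d. d dvd m}" "y \<in> {..a} \<times> {d. d dvd m}"
  obtain i d j e where [simp]: "x = (i, d)" "y = (j, e)" by force
  have nd: "\<not> p dvd d" "\<not> p dvd e" using xy assms(2) dvd_trans by auto
  show "((case x of (i, d) \<Rightarrow> p ^ i * d) = (case y of (i, d) \<Rightarrow> p ^ i * d)) = (x = y)"
  proof
    assume eq: "(case x of (i, d) \<Rightarrow> p ^ i * d) = (case y of (i, d) \<Rightarrow> p ^ i * d)"
    have "multiplicity p (p ^ i * d) = i" "multiplicity p (p ^ j * e) = j"
      using assms(1) nd by (auto intro!: multiplicity_eqI simp: prime_gt_0_nat)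
    then have "i = j" using eq by auto
    then show "x = y" using eq assms(1) by (simp add: prime_gt_0_nat)
  qed simp
next
  fix x assume "x \<in> {..a} \<times> {d. d dvd m}"
  then show "(case x of (i, d) \<Rightarrow> p ^ i * d) \<in> {d. d dvd p ^ a * m}"
    by (auto intro: mult_dvd_mono le_imp_power_dvd)
next
  fix y assume "y \<in> {d. d dvd p ^ a * m}"
  then obtain b c where "y = b * c" "b dvd p ^ a" "c dvd m"
    using division_decomp[of y "p ^ a" m] by auto
  moreover obtain i where "i \<le> a" "b = p ^ i"
    using \<open>b dvd p ^ a\<close> divides_primepow_nat[OF assms(1)] by blast
  ultimately show "\<exists>x\<in>{..a} \<times> {d. d dvd m}. y = (case x of (i, d) \<Rightarrow> p ^ i * d)"
    by (intro bexI[of _ "(i, c)"]) auto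
qed

text \<open>Splits off the whole power of a prime at once, as suits multiplicative
  functions.\<close>

lemma nat_prime_power_induct [consumes 1, case_names one step]:
  fixes q :: nat
  assumes "q > 0" "P 1"
    and step: "\<And>p a m. \<lbrakk>prime p; \<not> p dvd m; m > 0; a > 0; P m\<rbrakk> \<Longrightarrow> P (p ^ a * m)"
  shows "P q"
  using assms(1)
proof (induction q rule: less_induct)
  case (less q)
  show ?case
  proof (cases "q = 1")
    case False
    then obtain p where p: "prime p" "p dvd q" using prime_factor_nat by blast
    have "q \<noteq> 0" "\<not> is_unit p" using less.prems p(1) not_prime_unit by auto
    then obtain m where m: "q = p ^ multiplicity p q * m" "\<not> p dvd m"
      by (rule multiplicity_decompose')
    have "multiplicity p q > 0" using p less.prems by (simp add: prime_multiplicity_gt_zero_iff)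
    have "m > 0" using m(1) less.prems by (cases m) auto
    have "1 < p ^ multiplicity p q"
      using one_less_power[OF prime_gt_1_nat[OF p(1)] \<open>multiplicity p q > 0\<close>] .
    then have "1 * m < p ^ multiplicity p q * m"
      using \<open>m > 0\<close> by (intro mult_strict_right_mono)
    then have "m < q" using m(1) by linarith
    from less.IH[OF this \<open>m > 0\<close>] show ?thesis
      by (subst m(1)) (rule step[OF p(1) m(2) \<open>m > 0\<close> \<open>multiplicity p q > 0\<close>])
  qed (use assms(2) in simp)
qed

lemma has_sum_finite_sum:
  fixes f :: "'a \<Rightarrow> 'b \<Rightarrow> real"
  assumes "finite A" "\<And>S. S \<in> A \<Longrightarrow> (f S has_sum c S) B"
  shows "((\<lambda>x. \<Sum>S\<in>A. f S x) has_sum (\<Sum>S\<in>A. c S)) B"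
  using assms
proof (induction A rule: finite_induct)
  case (insert S A)
  then show ?case using has_sum_add[OF insert.prems[of S] insert.IH] by simp
qed (simp add: has_sum_0)

text \<open>Abstracts the Jacobi symbol modulo \<open>n\<close>; the instance used is
  \<open>prodchar I\<close> below.\<close>

locale sign_character =
  fixes h :: "nat \<Rightarrow> real"
  assumes h_1: "h (Suc 0) = 1" and h_mult: "\<And>a b. h (a * b) = h a * h b"
    and h_range: "\<And>a. h a \<in> {-1, 0, 1}"
begin

definition divisor_sum :: "nat \<Rightarrow> real" where
  "divisor_sum q = (\<Sum>d | d dvd q. h d)"

lemma h_power: "h (a ^ k) = h a ^ k"
  by (induction k) (simp_all add: h_1 h_mult)

lemma divisor_sum_prime_power_mult:
  assumes "prime p" "\<not> p dvd m"
  shows "divisor_sum (p ^ a * m) = (\<Sum>i\<le>a. h p ^ i) * divisor_sum m"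
proof -
  have "divisor_sum (p ^ a * m) = (\<Sum>x\<in>{..a} \<times> {d. d dvd m}. h (case x of (i, d) \<Rightarrow> p ^ i * d))"
    unfolding divisor_sum_def
    using sum.reindex_bij_betw[OF divisors_prime_power_mult[OF assms], of h] by simp
  also have "\<dots> = (\<Sum>(i, d)\<in>{..a} \<times> {d. d dvd m}. h p ^ i * h d)"
    by (intro sum.cong) (auto simp: h_mult h_power)
  also have "\<dots> = (\<Sum>i\<le>a. h p ^ i) * divisor_sum m"
    unfolding divisor_sum_def by (simp add: sum_product sum.cartesian_product)
  finally show ?thesis .
qed

lemma sum_powers_minus_one: "(\<Sum>i\<le>a. (-1 :: real) ^ i) = (if even a then 1 else 0)"
  by (induction a) auto

lemma sum_powers_zero: "(\<Sum>i\<le>a. (0 :: real) ^ i) = 1"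
  by (induction a) auto

text \<open>Such a factor is \<open>a + 1\<close>, 1 or 0, and it is 0 only if
  \<open>h p = -1\<close> and \<open>a\<close> is odd. This governs where \<open>divisor_sum\<close>
  is nonnegative, positive or zero.\<close>

lemma sum_powers_nonneg: "(\<Sum>i\<le>a. h p ^ i) \<ge> 0"
  using h_range[of p] by (auto simp: sum_powers_minus_one sum_powers_zero)

lemma sum_powers_ge_1: "even a \<Longrightarrow> (\<Sum>i\<le>a. h p ^ i) \<ge> 1"
  using h_range[of p] by (auto simp: sum_powers_minus_one sum_powers_zero)

lemma divisor_sum_1: "divisor_sum (Suc 0) = 1"
  by (simp add: divisor_sum_def h_1)

lemma divisor_sum_nonneg: "q > 0 \<Longrightarrow> divisor_sum q \<ge> 0"
proof (induction q rule: nat_prime_power_induct)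
  case (step p a m)
  then show ?case using sum_powers_nonneg by (simp add: divisor_sum_prime_power_mult)
qed (simp add: divisor_sum_1)

text \<open>All prime exponents of a square are even, so every local factor is at least 1.\<close>

lemma divisor_sum_square: "k > 0 \<Longrightarrow> divisor_sum (k\<^sup>2) \<ge> 1"
proof (induction k rule: nat_prime_power_induct)
  case (step p a m)
  have "\<not> p dvd m\<^sup>2" using step prime_dvd_power by blast
  then have "divisor_sum (p ^ (2 * a) * m\<^sup>2) = (\<Sum>i\<le>2 * a. h p ^ i) * divisor_sum (m\<^sup>2)"
    using step by (intro divisor_sum_prime_power_mult)
  moreover have "1 * 1 \<le> (\<Sum>i\<le>2 * a. h p ^ i) * divisor_sum (m\<^sup>2)"
    using step by (intro mult_mono sum_powers_ge_1 sum_powers_nonneg) auto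
  moreover have "(p ^ a * m)\<^sup>2 = p ^ (2 * a) * m\<^sup>2"
    by (simp add: power_mult_distrib mult.commute flip: power_mult)
  ultimately show ?case by simp
qed (simp add: divisor_sum_1)

text \<open>The local factor at \<open>p\<close> vanishes. Read contrapositively, a nonzero divisor
  sum excludes \<open>h p = -1\<close> at every prime of odd multiplicity in
  \<open>q\<close>.\<close>

lemma divisor_sum_eq_0:
  assumes "q > 0" "prime p" "h p = -1" "odd (multiplicity p q)"
  shows "divisor_sum q = 0"
proof -
  have "q \<noteq> 0" "\<not> is_unit p" using assms not_prime_unit by auto
  then obtain m where m: "q = p ^ multiplicity p q * m" "\<not> p dvd m"
    by (rule multiplicity_decompose')
  show ?thesis
    by (subst m(1), subst divisor_sum_prime_power_mult[OF assms(2) m(2)])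
       (simp add: assms(3,4) sum_powers_minus_one)
qed

lemma divisor_sum_pairs:
  assumes "q > 0"
  shows "divisor_sum q = (\<Sum>(i, j) | Suc i * Suc j = q. h (Suc i))"
proof -
  have "bij_betw (\<lambda>(i, j). Suc i) {(i, j). Suc i * Suc j = q} {d. d dvd q}"
  proof (rule bij_betwI')
    fix x y assume "x \<in> {(i, j). Suc i * Suc j = q}" "y \<in> {(i, j). Suc i * Suc j = q}"
    then show "((case x of (i, j) \<Rightarrow> Suc i) = (case y of (i, j) \<Rightarrow> Suc i)) = (x = y)"
      by (auto simp del: mult_Suc mult_Suc_right simp: mult_cancel1)
  next
    fix x assume "x \<in> {(i, j). Suc i * Suc j = q}"
    then show "(case x of (i, j) \<Rightarrow> Suc i) \<in> {d. d dvd q}"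
      by (auto simp del: mult_Suc mult_Suc_right)
  next
    fix d assume "d \<in> {d. d dvd q}"
    then obtain k where k: "q = d * k" by auto
    obtain i j where "d = Suc i" "k = Suc j"
      using k assms by (metis gr0_implies_Suc nat_0_less_mult_iff)
    then show "\<exists>x\<in>{(i, j). Suc i * Suc j = q}. d = (case x of (i, j) \<Rightarrow> Suc i)"
      using k by (intro bexI[of _ "(i, j)"]) auto
  qed
  from sum.reindex_bij_betw[OF this, of h] show ?thesis
    unfolding divisor_sum_def by (simp add: case_prod_unfold)
qed

end

section \<open>Real characters modulo n and their Lambert series\<close>

text \<open>The model is the family of Legendre symbols at the prime factors of \<open>n\<close>.
  The assumption \<open>indep\<close> says that no product over a nonempty subset is the principal
  character.\<close>

locale independent_characters =
  fixes I :: "nat set" and \<chi> :: "nat \<Rightarrow> nat \<Rightarrow> real" and n :: nat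
  assumes n_pos: "n > 0" and fin: "finite I" and nonempty: "I \<noteq> {}"
    and mult: "\<And>i a b. i \<in> I \<Longrightarrow> \<chi> i (a * b) = \<chi> i a * \<chi> i b"
    and vals: "\<And>i a. i \<in> I \<Longrightarrow> coprime a n \<Longrightarrow> \<chi> i a = 1 \<or> \<chi> i a = -1"
    and periodic: "\<And>i a. i \<in> I \<Longrightarrow> \<chi> i (a + n) = \<chi> i a"
    and indep: "\<And>S. S \<subseteq> I \<Longrightarrow> S \<noteq> {} \<Longrightarrow> \<exists>a. coprime a n \<and> (\<Prod>i\<in>S. \<chi> i a) = -1"
begin

text \<open>Cutting off outside the units gives all these products the common modulus
  \<open>n\<close>; for \<open>S = {}\<close> the result is the principal character.\<close>

definition prodchar :: "nat set \<Rightarrow> nat \<Rightarrow> real" where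
  "prodchar S d = (if coprime d n then \<Prod>i\<in>S. \<chi> i d else 0)"

lemma prodchar_coprime:
  assumes "S \<subseteq> I" "coprime d n"
  shows "prodchar S d = 1 \<or> prodchar S d = -1"
proof -
  have "(\<Prod>i\<in>S. \<chi> i d) = 1 \<or> (\<Prod>i\<in>S. \<chi> i d) = -1"
    using finite_subset[OF assms(1) fin] assms(1)
  proof (induction S rule: finite_induct)
    case (insert i S)
    then show ?case using vals[of i d] assms(2) by auto
  qed simp
  then show ?thesis using assms(2) by (simp add: prodchar_def)
qed

lemma prodchar_range: "S \<subseteq> I \<Longrightarrow> prodchar S d \<in> {-1, 0, 1}"
  using prodchar_coprime[of S d] by (cases "coprime d n") (auto simp: prodchar_def)

lemma prodchar_le_1: "S \<subseteq> I \<Longrightarrow> \<bar>prodchar S d\<bar> \<le> 1"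
  using prodchar_range[of S d] by auto

lemma prodchar_mult:
  assumes "S \<subseteq> I"
  shows "prodchar S (a * b) = prodchar S a * prodchar S b"
proof -
  have "(\<Prod>i\<in>S. \<chi> i (a * b)) = (\<Prod>i\<in>S. \<chi> i a * \<chi> i b)"
    using assms mult by (intro prod.cong) auto
  then show ?thesis by (simp add: prodchar_def prod.distrib)
qed

lemma prodchar_periodic: "S \<subseteq> I \<Longrightarrow> prodchar S (a + n) = prodchar S a"
proof -
  assume S: "S \<subseteq> I"
  have "coprime (a + n) n = coprime a n" by (simp only: coprime_iff_gcd_eq_1 gcd_add1)
  moreover have "(\<Prod>i\<in>S. \<chi> i (a + n)) = (\<Prod>i\<in>S. \<chi> i a)"
    using S periodic by (intro prod.cong) auto
  ultimately show ?thesis by (simp add: prodchar_def)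
qed

lemma prodchar_mod: "S \<subseteq> I \<Longrightarrow> prodchar S (a mod n) = prodchar S a"
proof -
  assume S: "S \<subseteq> I"
  have "prodchar S (a mod n + k * n) = prodchar S (a mod n)" for k
  proof (induction k)
    case (Suc k)
    have "prodchar S (a mod n + Suc k * n) = prodchar S (a mod n + k * n + n)"
      by (simp add: algebra_simps)
    then show ?case using Suc prodchar_periodic[OF S] by simp
  qed simp
  from this[of "a div n"] show ?thesis by simp
qed

lemma prodchar_1: "prodchar S (Suc 0) = 1" if "S \<subseteq> I"
proof -
  have "\<chi> i (Suc 0) = 1" if "i \<in> S" for i
  proof -
    have "i \<in> I" using that \<open>S \<subseteq> I\<close> by blast
    from mult[OF this, of 1 1] vals[OF this, of 1] show ?thesis by auto
  qed
  then show ?thesis by (simp add: prodchar_def)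
qed

text \<open>Multiplication by a unit \<open>a\<close> with character value -1 permutes the residues
  and negates the sum.\<close>

lemma sum_prodchar:
  assumes "S \<subseteq> I" "S \<noteq> {}"
  shows "sum (prodchar S) {..<n} = 0"
proof -
  obtain a where a: "coprime a n" "(\<Prod>i\<in>S. \<chi> i a) = -1" using indep[OF assms] by blast
  have "inj_on (\<lambda>d. a * d mod n) {..<n}"
  proof (rule inj_onI)
    fix x y assume "x \<in> {..<n}" "y \<in> {..<n}" "a * x mod n = a * y mod n"
    then show "x = y"
      using a(1) by (metis cong_def cong_mult_lcancel_nat lessThan_iff mod_less)
  qed
  moreover have "(\<lambda>d. a * d mod n) ` {..<n} \<subseteq> {..<n}" using n_pos by auto
  ultimately have "bij_betw (\<lambda>d. a * d mod n) {..<n} {..<n}"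
    by (simp add: bij_betw_def endo_inj_surj)
  then have "sum (prodchar S) {..<n} = (\<Sum>d<n. prodchar S (a * d mod n))"
    by (rule sum.reindex_bij_betw[symmetric])
  also have "\<dots> = (\<Sum>d<n. - prodchar S d)"
    by (intro sum.cong refl)
       (use a assms(1) in \<open>simp add: prodchar_mod prodchar_mult, simp add: prodchar_def\<close>)
  also have "\<dots> = - sum (prodchar S) {..<n}" by (simp add: sum_negf)
  finally show ?thesis by simp
qed

sublocale full: sign_character "prodchar I"
  by unfold_locales (use prodchar_range[of I] in \<open>simp_all add: prodchar_1 prodchar_mult\<close>)

lemma prodchar_full_mult:
  assumes "S \<subseteq> I" "coprime d n"
  shows "prodchar I d * prodchar S d = prodchar (I - S) d"
proof -
  have "prodchar I d = prodchar (I - S) d * prodchar S d"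
    using assms prod.subset_diff[OF assms(1) fin] by (simp add: prodchar_def)
  moreover have "prodchar S d * prodchar S d = 1"
    using prodchar_coprime[OF assms] by auto
  ultimately show ?thesis by (simp add: mult.assoc)
qed

definition mixed_sum :: "real \<Rightarrow> nat set \<Rightarrow> real" where
  "mixed_sum t S = infsum (lambert_term (prodchar (I - S)) (prodchar S) t) UNIV"

lemma mixed_term_summable:
  assumes "0 < t" "t < 1" "S \<subseteq> I"
  shows "lambert_term (prodchar (I - S)) (prodchar S) t summable_on UNIV"
  by (rule abs_summable_summable[OF lambert_term_abs_summable])
     (use assms prodchar_le_1 in auto)

text \<open>Exchanging the two summation indices exchanges the two characters.\<close>

lemma mixed_sum_full: "mixed_sum t I = mixed_sum t {}"
proof -
  have "bij_betw prod.swap UNIV (UNIV :: (nat \<times> nat) set)" by simp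
  from infsum_reindex_bij_betw[OF this, of "lambert_term (prodchar I) (prodchar {}) t"]
  have "mixed_sum t {} = (\<Sum>\<^sub>\<infinity>x. lambert_term (prodchar I) (prodchar {}) t (prod.swap x))"
    by (simp add: mixed_sum_def)
  also have "\<dots> = mixed_sum t I"
    unfolding mixed_sum_def by (intro infsum_cong) (auto simp: lambert_term_def mult_ac simp del: mult_Suc mult_Suc_right)
  finally show ?thesis ..
qed

text \<open>Both \<open>S\<close> and its complement in \<open>I\<close> are nonempty, so both
  characters sum to 0 over a period.\<close>

lemma mixed_sum_bounded:
  assumes "S \<subseteq> I" "S \<noteq> {}" "S \<noteq> I"
  shows "\<exists>C. \<forall>t. 0 < t \<and> t < 1 \<longrightarrow> \<bar>mixed_sum t S\<bar> \<le> C"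
proof -
  have "I - S \<subseteq> I" "I - S \<noteq> {}" using assms by auto
  then show ?thesis unfolding mixed_sum_def
    using assms by (intro lambert_sum_bounded[OF n_pos] prodchar_periodic prodchar_le_1 sum_prodchar)
qed

text \<open>Grouped by products, the series is the sum of \<open>full.divisor_sum q * t ^ q\<close>
  over \<open>q\<close> coprime to \<open>n\<close>. Its terms are nonnegative, and only the squares
  of \<open>1 + k * n\<close> with \<open>k < m\<close> are kept; these are distinct and coprime to
  \<open>n\<close>.\<close>

lemma mixed_sum_empty_ge:
  assumes t: "0 < t" "t < 1"
  shows "mixed_sum t {} \<ge> (\<Sum>k<m. t ^ (1 + k * n)\<^sup>2)"
proof -
  let ?F = "lambert_term (prodchar I) (prodchar {}) t"
  let ?G = "\<lambda>q. \<Sum>(i, j) | Suc i * Suc j = q. ?F (i, j)"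
  have summ: "?F summable_on UNIV" using mixed_term_summable[OF t, of "{}"] by simp
  have G: "?G q = (if coprime q n then full.divisor_sum q * t ^ q else 0)" if "q > 0" for q
  proof -
    have "?G q = (\<Sum>(i, j) | Suc i * Suc j = q. (if coprime q n then prodchar I (Suc i) * t ^ q else 0))"
      by (intro sum.cong) (auto simp: lambert_term_def prodchar_def simp del: mult_Suc mult_Suc_right)
    then show ?thesis using that by (simp add: full.divisor_sum_pairs sum_distrib_right case_prod_unfold)
  qed
  have G0: "?G 0 = 0" by simp
  define sq where "sq = (\<lambda>k. (1 + k * n)\<^sup>2)"
  have inj: "inj_on sq {..<m}"
  proof (rule inj_onI)
    fix x y assume "sq x = sq y"
    then have "1 + x * n = 1 + y * n"
      unfolding sq_def by (rule power2_eq_imp_eq) simp_all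
    then show "x = y" using n_pos by simp
  qed
  have "(\<Sum>k<m. t ^ sq k) \<le> (\<Sum>k<m. ?G (sq k))"
  proof (rule sum_mono)
    fix k
    have "coprime (1 + k * n) n"
      by (rule coprimeI) (metis dvd_add_left_iff dvd_mult)
    then have "coprime (sq k) n" by (simp add: sq_def)
    moreover have "sq k > 0" by (simp add: sq_def)
    moreover have "full.divisor_sum (sq k) \<ge> 1" unfolding sq_def by (rule full.divisor_sum_square) simp
    ultimately show "t ^ sq k \<le> ?G (sq k)" unfolding G[OF \<open>sq k > 0\<close>] using t by simp
  qed
  also have "\<dots> = sum ?G (sq ` {..<m})" using inj by (simp add: sum.reindex)
  also have "\<dots> \<le> infsum ?G UNIV"
  proof (rule finite_sum_le_infsum[OF lambert_sum_by_divisors(1)[OF summ]])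
    fix q show "?G q \<ge> 0"
      using G0 G[of q] full.divisor_sum_nonneg[of q] t by (cases "q = 0") auto
  qed auto
  also have "\<dots> = mixed_sum t {}"
    unfolding mixed_sum_def using lambert_sum_by_divisors(2)[OF summ] by simp
  finally show ?thesis by (simp add: sq_def)
qed

text \<open>With \<open>d = Suc i\<close> and \<open>e = Suc j\<close>, the product over
  \<open>I\<close> expands into a sum over subsets \<open>S\<close>. Since
  \<open>prodchar S d\<close> squares to 1 on units, multiplying \<open>prodchar S (d * e)\<close>
  by \<open>prodchar I d\<close> yields \<open>prodchar (I - S) d * prodchar S e\<close>.\<close>

lemma mixed_sum_expansion:
  assumes "Suc i * Suc j = q"
  shows "(\<Sum>S\<in>Pow I. prod \<epsilon> S * lambert_term (prodchar (I - S)) (prodchar S) t (i, j))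
    = (if coprime q n then (\<Prod>k\<in>I. 1 + \<epsilon> k * \<chi> k q) else 0) * prodchar I (Suc i) * t ^ q"
proof (cases "coprime q n")
  case True
  then have "coprime (Suc i * Suc j) n" by (simp only: assms)
  then have cop: "coprime (Suc i) n" by (simp only: coprime_mult_left_iff)
  have "(\<Prod>k\<in>I. 1 + \<epsilon> k * \<chi> k q) = (\<Sum>S\<in>Pow I. \<Prod>k\<in>S. \<epsilon> k * \<chi> k q)"
    using prod_add[OF fin, of "\<lambda>k. \<epsilon> k * \<chi> k q" "\<lambda>_. 1"]
    by (simp only: add.commute[of 1] prod.neutral_const mult_1_right)
  also have "\<dots> = (\<Sum>S\<in>Pow I. prod \<epsilon> S * prodchar S q)"
    using True by (simp add: prodchar_def prod.distrib)
  finally have expand: "(\<Prod>k\<in>I. 1 + \<epsilon> k * \<chi> k q) = (\<Sum>S\<in>Pow I. prod \<epsilon> S * prodchar S q)" .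
  have "(\<Prod>k\<in>I. 1 + \<epsilon> k * \<chi> k q) * prodchar I (Suc i) * t ^ q
      = (\<Sum>S\<in>Pow I. prod \<epsilon> S * (prodchar I (Suc i) * prodchar S q) * t ^ q)"
    unfolding expand sum_distrib_right by (simp add: mult_ac)
  also have "\<dots> = (\<Sum>S\<in>Pow I. prod \<epsilon> S * lambert_term (prodchar (I - S)) (prodchar S) t (i, j))"
  proof (intro sum.cong refl)
    fix S assume "S \<in> Pow I"
    then have "prodchar I (Suc i) * prodchar S q = prodchar (I - S) (Suc i) * prodchar S (Suc j)"
      using prodchar_full_mult[of S "Suc i"] cop
      by (simp add: prodchar_mult mult.assoc[symmetric] flip: assms del: mult_Suc mult_Suc_right)
    then show "prod \<epsilon> S * (prodchar I (Suc i) * prodchar S q) * t ^ q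
        = prod \<epsilon> S * lambert_term (prodchar (I - S)) (prodchar S) t (i, j)"
      unfolding lambert_term_def prod.case assms by simp
  qed
  finally show ?thesis using True by simp
next
  case False
  then have "prodchar (I - S) (Suc i) * prodchar S (Suc j) = 0" for S
    unfolding assms[symmetric] coprime_mult_left_iff by (auto simp: prodchar_def)
  then have "lambert_term (prodchar (I - S)) (prodchar S) t (i, j) = 0" for S
    by (simp only: lambert_term_def prod.case mult_zero_left)
  then show ?thesis using False by simp
qed

theorem exists_prescribed_characters:
  assumes \<epsilon>: "\<And>i. i \<in> I \<Longrightarrow> \<epsilon> i = 1 \<or> \<epsilon> i = -1" and prod: "prod \<epsilon> I = (1 :: real)"
  obtains q where "q > 0" "coprime q n" "\<And>i. i \<in> I \<Longrightarrow> \<chi> i q = \<epsilon> i" "full.divisor_sum q \<noteq> 0"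
proof (rule ccontr)
  assume none: "\<not> thesis"
  note found = that
  have zero: "(\<Sum>S\<in>Pow I. prod \<epsilon> S * mixed_sum t S) = 0" if t: "0 < t" "t < 1" for t
  proof -
    let ?T = "\<lambda>S. lambert_term (prodchar (I - S)) (prodchar S) t"
    let ?F = "\<lambda>x. \<Sum>S\<in>Pow I. prod \<epsilon> S * ?T S x"
    have hs: "(?F has_sum (\<Sum>S\<in>Pow I. prod \<epsilon> S * mixed_sum t S)) UNIV"
    proof (rule has_sum_finite_sum)
      fix S assume "S \<in> Pow I"
      then have "?T S summable_on UNIV" using mixed_term_summable[OF t] by simp
      then show "((\<lambda>x. prod \<epsilon> S * ?T S x) has_sum prod \<epsilon> S * mixed_sum t S) UNIV"
        unfolding mixed_sum_def by (intro has_sum_cmult_right has_sum_infsum)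
    qed (use fin in simp)
    have "(\<Sum>(i, j) | Suc i * Suc j = q. ?F (i, j)) = 0" for q
    proof (cases "q = 0")
      case False
      let ?P = "if coprime q n then (\<Prod>k\<in>I. 1 + \<epsilon> k * \<chi> k q) else 0"
      have "(\<Sum>(i, j) | Suc i * Suc j = q. ?F (i, j))
          = (\<Sum>(i, j) | Suc i * Suc j = q. ?P * prodchar I (Suc i) * t ^ q)"
        by (intro sum.cong refl) (use mixed_sum_expansion in \<open>auto simp del: mult_Suc mult_Suc_right\<close>)
      also have "\<dots> = ?P * full.divisor_sum q * t ^ q"
        using False
        by (simp add: full.divisor_sum_pairs sum_distrib_right sum_distrib_left case_prod_unfold)
      \<comment> \<open>A factor \<open>1 + \<epsilon> i * \<chi> i q\<close> is nonzero only if the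
        two signs agree, so a nonzero product would make \<open>q\<close> a solution.\<close>
      also have "?P * full.divisor_sum q = 0"
      proof (rule ccontr)
        assume *: "?P * full.divisor_sum q \<noteq> 0"
        then have cop: "coprime q n" by (auto split: if_splits)
        have "\<chi> i q = \<epsilon> i" if "i \<in> I" for i
        proof -
          have "1 + \<epsilon> i * \<chi> i q \<noteq> 0" using * cop that fin by auto
          then show ?thesis using \<epsilon>[OF that] vals[OF that cop] by auto
        qed
        then show False using none found[of q] cop False * by auto
      qed
      finally show ?thesis by simp
    qed simp
    then have "infsum ?F UNIV = 0"
      using lambert_sum_by_divisors(2)[of ?F] has_sum_imp_summable[OF hs] by simp
    then show ?thesis using infsumI[OF hs] by simp
  qed
  have "\<forall>S\<in>Pow I - {{}, I}. \<exists>C. \<forall>t. 0 < t \<and> t < 1 \<longrightarrow> \<bar>mixed_sum t S\<bar> \<le> C"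
    using mixed_sum_bounded by auto
  then obtain C where C: "\<And>S t. S \<in> Pow I - {{}, I} \<Longrightarrow> 0 < t \<Longrightarrow> t < 1 \<Longrightarrow> \<bar>mixed_sum t S\<bar> \<le> C S"
    by metis
  define C0 where "C0 = (\<Sum>S\<in>Pow I - {{}, I}. C S)"
  have le: "mixed_sum t {} \<le> C0 / 2" if t: "0 < t" "t < 1" for t
  proof -
    have "(\<Sum>S\<in>Pow I. prod \<epsilon> S * mixed_sum t S)
        = (\<Sum>S\<in>Pow I - {{}, I}. prod \<epsilon> S * mixed_sum t S) + (\<Sum>S\<in>{{}, I}. prod \<epsilon> S * mixed_sum t S)"
      using fin by (intro sum.subset_diff) auto
    \<comment> \<open>Here \<open>prod \<epsilon> I = 1\<close> is essential: the two extreme terms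
      are equal and add up instead of cancelling.\<close>
    also have "(\<Sum>S\<in>{{}, I}. prod \<epsilon> S * mixed_sum t S) = 2 * mixed_sum t {}"
      using nonempty prod by (simp add: mixed_sum_full)
    finally have "2 * mixed_sum t {} = - (\<Sum>S\<in>Pow I - {{}, I}. prod \<epsilon> S * mixed_sum t S)"
      using zero[OF t] by simp
    also have "\<dots> \<le> (\<Sum>S\<in>Pow I - {{}, I}. \<bar>prod \<epsilon> S * mixed_sum t S\<bar>)"
      using sum_abs[of "\<lambda>S. prod \<epsilon> S * mixed_sum t S" "Pow I - {{}, I}"] by linarith
    also have "\<dots> \<le> C0" unfolding C0_def
    proof (rule sum_mono)
      fix S assume S: "S \<in> Pow I - {{}, I}"
      have "\<bar>prod \<epsilon> S\<bar> = (\<Prod>i\<in>S. \<bar>\<epsilon> i\<bar>)" by (rule abs_prod)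
      also have "\<dots> = (\<Prod>i\<in>S. 1)" using S \<epsilon> by (intro prod.cong) fastforce+
      finally show "\<bar>prod \<epsilon> S * mixed_sum t S\<bar> \<le> C S" using C[OF S t] by (simp add: abs_mult)
    qed
    finally show ?thesis by simp
  qed
  \<comment> \<open>By Bernoulli, \<open>t = 1 - 1 / (2 * N)\<close> gives
    \<open>t ^ N \<ge> 1 / 2\<close>. The first \<open>m\<close> exponents are at most
    \<open>N\<close>, so the lower bound is at least \<open>m / 2\<close>, which exceeds
    \<open>C0 / 2\<close>.\<close>
  obtain m :: nat where m: "real m > C0" using reals_Archimedean2 by blast
  define N where "N = (1 + m * n)\<^sup>2"
  define t where "t = 1 - 1 / (2 * real N)"
  have "N \<ge> 1" by (simp add: N_def)
  then have t: "0 < t" "t < 1" by (auto simp: t_def field_simps)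
  have "1 / 2 = 1 + real N * (- 1 / (2 * real N))" using \<open>N \<ge> 1\<close> by simp
  also have "\<dots> \<le> t ^ N"
    using Bernoulli_inequality[of "- 1 / (2 * real N)" N] \<open>N \<ge> 1\<close> by (simp add: t_def field_simps)
  finally have tN: "1 / 2 \<le> t ^ N" .
  have "real m / 2 = (\<Sum>k<m. 1 / 2 :: real)" by simp
  also have "\<dots> \<le> (\<Sum>k<m. t ^ (1 + k * n)\<^sup>2)"
  proof (rule sum_mono)
    fix k assume "k \<in> {..<m}"
    then have "(1 + k * n)\<^sup>2 \<le> N" unfolding N_def by (intro power_mono) auto
    then have "t ^ N \<le> t ^ (1 + k * n)\<^sup>2" using t by (intro power_decreasing) auto
    then show "1 / 2 \<le> t ^ (1 + k * n)\<^sup>2" using tN by simp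
  qed
  also have "\<dots> \<le> C0 / 2" using mixed_sum_empty_ge[OF t] le[OF t] by (rule order_trans)
  finally show False using m by simp
qed

end

section \<open>Sums of three squares\<close>

lemma Legendre_range: "Legendre a p \<in> {-1, 0, 1}"
  by (simp add: Legendre_def)

lemma Legendre_cong: "[a = b] (mod m) \<Longrightarrow> Legendre a m = Legendre b m"
  by (simp add: Legendre_def QuadRes_def cong_def)

text \<open>Two values among -1, 0, 1 differ by at most 2, which is less than
  \<open>p\<close>.\<close>

lemma Legendre_eqI:
  fixes p :: nat
  assumes "p > 2" "x \<in> {-1, 0, 1}" "y \<in> {-1, 0, 1 :: int}" "[x = y] (mod p)"
  shows "x = y"
proof -
  have "int p dvd x - y" using assms(4) by (simp add: cong_iff_dvd_diff)
  moreover have "\<bar>x - y\<bar> < int p" using assms(1-3) by auto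
  ultimately show ?thesis using zdvd_imp_le[of "int p" "\<bar>x - y\<bar>"] by fastforce
qed

lemma Legendre_mult:
  assumes "prime p" "p > 2"
  shows "Legendre (a * b) (int p) = Legendre a p * Legendre b p"
proof (rule Legendre_eqI[OF assms(2)])
  have "[Legendre (a * b) p = (a * b) ^ ((p - 1) div 2)] (mod p)"
    using assms by (rule euler_criterion)
  also have "(a * b) ^ ((p - 1) div 2) = a ^ ((p - 1) div 2) * b ^ ((p - 1) div 2)"
    by (rule power_mult_distrib)
  also have "[\<dots> = Legendre a p * Legendre b p] (mod p)"
    by (rule cong_mult[OF cong_sym[OF euler_criterion[OF assms]] cong_sym[OF euler_criterion[OF assms]]])
  finally show "[Legendre (a * b) p = Legendre a p * Legendre b p] (mod p)" .
  show "Legendre a (int p) * Legendre b (int p) \<in> {-1, 0, 1}"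
    using Legendre_range[of a p] Legendre_range[of b p] by auto
qed (rule Legendre_range)

lemma odd_prime_cases: "prime p \<Longrightarrow> p > 2 \<Longrightarrow> odd (p :: nat)"
  using prime_odd_nat by auto

lemma Legendre_minus_one:
  assumes "prime p" "p > 2"
  shows "Legendre (-1) (int p) = (if p mod 4 = 1 then 1 else -1)"
proof -
  have "Legendre (-1) p = (-1) ^ ((p - 1) div 2)"
    by (rule Legendre_eqI[OF assms(2) Legendre_range _ euler_criterion[OF assms]])
       (auto simp: minus_one_power_iff)
  moreover have "even ((p - 1) div 2) \<longleftrightarrow> p mod 4 = 1"
    using odd_prime_cases[OF assms] by presburger
  ultimately show ?thesis by (simp add: minus_one_power_iff)
qed

text \<open>Gauss's lemma: with \<open>h = (p - 1) / 2\<close> the doubles of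
  \<open>1, ..., h\<close> stay below \<open>p\<close>, and those exceeding \<open>h\<close> come
  from \<open>h div 2 < x \<le> h\<close>. The parity of their number depends on \<open>p\<close>
  modulo 8.\<close>

lemma Legendre_two:
  assumes "prime p" "p > 2"
  shows "Legendre 2 (int p) = (if p mod 8 = 1 \<or> p mod 8 = 7 then 1 else -1)"
proof -
  have odd: "odd p" using odd_prime_cases[OF assms] .
  have "\<not> [2 = 0] (mod int p)"
    using assms(2) by (simp add: cong_def)
  then interpret GAUSS p 2
    using assms by unfold_locales auto
  define h where "h = (int p - 1) div 2"
  have p: "int p = 2 * h + 1" using odd unfolding h_def by presburger
  have "h \<ge> 0" using assms(2) p by linarith
  have "C = (\<lambda>x. 2 * x) ` {0<..h}"
    unfolding C_def B_def A_def h_def[symmetric] image_image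
    using p by (intro image_cong) auto
  then have "E = (\<lambda>x. 2 * x) ` {h div 2<..h}"
    unfolding E_def h_def[symmetric] by (auto simp: image_iff)
  then have "card E = card {h div 2<..h}"
    by (simp add: card_image inj_on_def)
  then have "card E = nat (h - h div 2)" by simp
  moreover have "even (nat (h - h div 2)) \<longleftrightarrow> p mod 8 = 1 \<or> p mod 8 = 7"
  proof -
    have "even (nat (h - h div 2)) \<longleftrightarrow> even (h - h div 2)"
      using \<open>h \<ge> 0\<close> by (subst even_nat_iff) auto
    also have "\<dots> \<longleftrightarrow> int p mod 8 = 1 \<or> int p mod 8 = 7"
      using p by presburger
    also have "\<dots> \<longleftrightarrow> p mod 8 = 1 \<or> p mod 8 = 7"
      by presburger
    finally show ?thesis .
  qed
  ultimately show ?thesis using gauss_lemma by (simp add: minus_one_power_iff)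
qed

lemma Legendre_minus_two:
  assumes "prime p" "p > 2"
  shows "Legendre (-2) (int p) = (if p mod 8 = 1 \<or> p mod 8 = 3 then 1 else -1)"
proof -
  have "Legendre (-2) p = Legendre (-1) p * Legendre 2 p"
    using Legendre_mult[OF assms, of "-1" 2] by simp
  also have "\<dots> = (if p mod 8 = 1 \<or> p mod 8 = 3 then 1 else -1)"
  proof -
    have "p mod 8 \<in> {1, 3, 5, 7}" using odd_prime_cases[OF assms] by auto presburger
    moreover have "p mod 4 = p mod 8 mod 4" by (simp add: mod_mod_cancel)
    ultimately show ?thesis unfolding Legendre_minus_one[OF assms] Legendre_two[OF assms] by auto
  qed
  finally show ?thesis .
qed

lemma odd_mod_8: "odd (m :: nat) \<Longrightarrow> m mod 8 = 1 \<or> m mod 8 = 3 \<or> m mod 8 = 5 \<or> m mod 8 = 7"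
  by presburger

lemma odd_prod: "finite I \<Longrightarrow> (\<And>p. p \<in> I \<Longrightarrow> odd (p :: nat)) \<Longrightarrow> odd (\<Prod>I)"
  by (induction I rule: finite_induct) auto

text \<open>On odd numbers these signs are the Jacobi symbols of 2 and -2, which depend only on the
  residue modulo 8; the 16 pairs of residues are checked.\<close>

lemma sign_mod_8_mult:
  fixes m k :: nat
  assumes "odd m" "odd k"
  shows "(if (m * k) mod 8 = 1 \<or> (m * k) mod 8 = 7 then 1 else -1 :: int)
      = (if m mod 8 = 1 \<or> m mod 8 = 7 then 1 else -1) * (if k mod 8 = 1 \<or> k mod 8 = 7 then 1 else -1)"
    and "(if (m * k) mod 8 = 1 \<or> (m * k) mod 8 = 3 then 1 else -1 :: int)
      = (if m mod 8 = 1 \<or> m mod 8 = 3 then 1 else -1) * (if k mod 8 = 1 \<or> k mod 8 = 3 then 1 else -1)"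
proof -
  have *: "(m * k) mod 8 = ((m mod 8) * (k mod 8)) mod 8" by (simp add: mod_mult_eq)
  show "(if (m * k) mod 8 = 1 \<or> (m * k) mod 8 = 7 then 1 else -1 :: int)
      = (if m mod 8 = 1 \<or> m mod 8 = 7 then 1 else -1) * (if k mod 8 = 1 \<or> k mod 8 = 7 then 1 else -1)"
    unfolding * using odd_mod_8[OF assms(1)] odd_mod_8[OF assms(2)] by (elim disjE) simp_all
  show "(if (m * k) mod 8 = 1 \<or> (m * k) mod 8 = 3 then 1 else -1 :: int)
      = (if m mod 8 = 1 \<or> m mod 8 = 3 then 1 else -1) * (if k mod 8 = 1 \<or> k mod 8 = 3 then 1 else -1)"
    unfolding * using odd_mod_8[OF assms(1)] odd_mod_8[OF assms(2)] by (elim disjE) simp_all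
qed

text \<open>The proposition \<open>P\<close> will be \<open>p mod 4 = 1\<close>, the case in which
  the reciprocity sign is constantly 1.\<close>

lemma sign_mod_4_mult:
  fixes m k :: nat
  assumes "odd m" "odd k"
  shows "(if P \<or> (m * k) mod 4 = 1 then 1 else -1 :: int)
      = (if P \<or> m mod 4 = 1 then 1 else -1) * (if P \<or> k mod 4 = 1 then 1 else -1)"
proof -
  have *: "(m * k) mod 4 = ((m mod 4) * (k mod 4)) mod 4" by (simp add: mod_mult_eq)
  have "m mod 4 = 1 \<or> m mod 4 = 3" "k mod 4 = 1 \<or> k mod 4 = 3" using assms by presburger+
  then show ?thesis unfolding * by (elim disjE) simp_all
qed

lemma prod_Legendre_two:
  assumes "finite I" "\<And>p. p \<in> I \<Longrightarrow> prime p \<and> p > 2"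
  shows "(\<Prod>p\<in>I. Legendre 2 (int p)) = (if \<Prod>I mod 8 = 1 \<or> \<Prod>I mod 8 = 7 then 1 else -1)"
  using assms
proof (induction I rule: finite_induct)
  case (insert p I)
  have oI: "odd (\<Prod>I)" using insert odd_prime_cases by (intro odd_prod) auto
  have op: "odd p" using insert.prems odd_prime_cases by blast
  have "(\<Prod>p\<in>insert p I. Legendre 2 (int p))
      = (if p mod 8 = 1 \<or> p mod 8 = 7 then 1 else -1) * (if \<Prod>I mod 8 = 1 \<or> \<Prod>I mod 8 = 7 then 1 else -1)"
    using insert Legendre_two[of p] by simp
  moreover have "\<Prod>(insert p I) = p * \<Prod>I" using insert.hyps by simp
  ultimately show ?case by (simp only: sign_mod_8_mult[OF op oI])
qed simp

lemma prod_Legendre_minus_two: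
  assumes "finite I" "\<And>p. p \<in> I \<Longrightarrow> prime p \<and> p > 2"
  shows "(\<Prod>p\<in>I. Legendre (-2) (int p)) = (if \<Prod>I mod 8 = 1 \<or> \<Prod>I mod 8 = 3 then 1 else -1)"
  using assms
proof (induction I rule: finite_induct)
  case (insert p I)
  have oI: "odd (\<Prod>I)" using insert odd_prime_cases by (intro odd_prod) auto
  have op: "odd p" using insert.prems odd_prime_cases by blast
  have "(\<Prod>p\<in>insert p I. Legendre (-2) (int p))
      = (if p mod 8 = 1 \<or> p mod 8 = 3 then 1 else -1) * (if \<Prod>I mod 8 = 1 \<or> \<Prod>I mod 8 = 3 then 1 else -1)"
    using insert Legendre_minus_two[of p] by simp
  moreover have "\<Prod>(insert p I) = p * \<Prod>I" using insert.hyps by simp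
  ultimately show ?case by (simp only: sign_mod_8_mult[OF op oI])
qed simp

text \<open>Jacobi's reciprocity for the squarefree number \<open>\<Prod>I\<close>, obtained by
  multiplying quadratic reciprocity over its primes.\<close>

lemma prod_Legendre_reciprocity:
  assumes "finite I" "\<And>r. r \<in> I \<Longrightarrow> prime r \<and> r > 2" "prime p" "p > 2" "p \<notin> I"
  shows "(\<Prod>r\<in>I. Legendre (int p) (int r)) * Legendre (int (\<Prod>I)) (int p)
    = (if p mod 4 = 1 \<or> \<Prod>I mod 4 = 1 then 1 else -1)"
  using assms
proof (induction I rule: finite_induct)
  case empty
  have "Legendre 1 (int p) * Legendre 1 p = Legendre 1 p" "Legendre 1 (int p) \<noteq> 0"
    using Legendre_mult[of p 1 1] empty by (auto simp: Legendre_def cong_def)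
  then show ?case by simp
next
  case (insert r I)
  have r: "prime r" "r > 2" "p \<noteq> r" using insert.prems by auto
  have "Legendre p r * Legendre r p = (-1) ^ ((p - 1) div 2 * ((r - 1) div 2))"
    using Quadratic_Reciprocity[of p r] insert.prems r by simp
  also have "\<dots> = (if p mod 4 = 1 \<or> r mod 4 = 1 then 1 else -1)"
  proof -
    have "even ((p - 1) div 2) \<longleftrightarrow> p mod 4 = 1" "even ((r - 1) div 2) \<longleftrightarrow> r mod 4 = 1"
      using odd_prime_cases[OF insert.prems(2,3)] odd_prime_cases[OF r(1,2)] by presburger+
    then show ?thesis by (simp add: minus_one_power_iff)
  qed
  finally have 1: "Legendre p r * Legendre r p = (if p mod 4 = 1 \<or> r mod 4 = 1 then 1 else -1)" .
  have 2: "Legendre (int (\<Prod>(insert r I))) p = Legendre r p * Legendre (int (\<Prod>I)) p"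
    using insert.hyps Legendre_mult[OF insert.prems(2,3), of r "int (\<Prod>I)"] by simp
  have IH: "(\<Prod>r\<in>I. Legendre (int p) (int r)) * Legendre (int (\<Prod>I)) (int p)
    = (if p mod 4 = 1 \<or> \<Prod>I mod 4 = 1 then 1 else -1)"
    using insert by simp
  have "(\<Prod>r\<in>insert r I. Legendre (int p) (int r)) * Legendre (int (\<Prod>(insert r I))) (int p)
    = (Legendre p r * Legendre r p)
      * ((\<Prod>r\<in>I. Legendre (int p) (int r)) * Legendre (int (\<Prod>I)) (int p))"
    unfolding 2 using insert.hyps by simp
  also have "\<dots> = (if p mod 4 = 1 \<or> (r * \<Prod>I) mod 4 = 1 then 1 else -1)"
  proof -
    have "odd (\<Prod>I)" using insert odd_prime_cases by (intro odd_prod) auto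
    from sign_mod_4_mult[OF odd_prime_cases[OF r(1,2)] this] show ?thesis unfolding 1 IH by simp
  qed
  also have "r * \<Prod>I = \<Prod>(insert r I)" using insert.hyps by simp
  finally show ?case .
qed

lemma Legendre_eq_1D: "Legendre a m = 1 \<Longrightarrow> \<exists>t. [t\<^sup>2 = a] (mod m)"
  by (auto simp: Legendre_def QuadRes_def split: if_splits)

lemma Legendre_coprime:
  assumes "prime r" "coprime a r"
  shows "Legendre (int a) (int r) = 1 \<or> Legendre (int a) (int r) = -1"
proof -
  have "\<not> r dvd a"
  proof
    assume "r dvd a"
    then have "is_unit r" by (rule coprime_common_divisor[OF assms(2)]) simp
    then show False using assms(1) not_prime_unit by blast
  qed
  then have "\<not> [int a = 0] (mod int r)" by (simp add: cong_0_iff)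
  then show ?thesis by (simp add: Legendre_def)
qed

text \<open>Squaring on the nonzero residues identifies 1 with \<open>r - 1\<close>, so on this
  finite set it is not surjective either.\<close>

lemma exists_nonresidue:
  assumes "prime r" "r > 2"
  shows "\<exists>g::nat. Legendre (int g) (int r) = -1"
proof -
  let ?A = "{1..<r}" and ?f = "\<lambda>x. x\<^sup>2 mod r"
  have sub: "?f ` ?A \<subseteq> ?A"
  proof
    fix y assume "y \<in> ?f ` ?A"
    then obtain x where x: "x \<in> ?A" "y = x\<^sup>2 mod r" by auto
    then have "\<not> r dvd x" using nat_dvd_not_less by auto
    then have "\<not> r dvd x\<^sup>2" using assms(1) prime_dvd_power by blast
    then show "y \<in> ?A" using x assms(1) by (auto simp: dvd_eq_mod_eq_0 prime_gt_0_nat)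
  qed
  have "(r - 1)\<^sup>2 mod r = 1\<^sup>2 mod r"
  proof -
    have "int ((r - 1)\<^sup>2) = (int r - 1)\<^sup>2" using assms(2) by (simp add: of_nat_diff)
    also have "\<dots> = 1 + int r * (int r - 2)" by (simp add: power2_eq_square algebra_simps)
    finally have "int ((r - 1)\<^sup>2) mod int r = 1 mod int r" by simp
    then have "int ((r - 1)\<^sup>2 mod r) = int (1\<^sup>2 mod r)" by (simp only: zmod_int) simp
    then show ?thesis by (simp only: of_nat_eq_iff)
  qed
  moreover have "r - 1 \<in> ?A" "1 \<in> ?A" "r - 1 \<noteq> 1" using assms(2) by auto
  ultimately have "\<not> inj_on ?f ?A" by (metis inj_onD)
  then have "?f ` ?A \<noteq> ?A" using eq_card_imp_inj_on[of ?A ?f] by auto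
  then obtain g where g: "g \<in> ?A" "g \<notin> ?f ` ?A" using sub by blast
  have "\<not> r dvd g" using g(1) nat_dvd_not_less by auto
  then have "\<not> [int g = 0] (mod int r)" by (simp add: cong_0_iff)
  moreover have "\<not> QuadRes (int r) (int g)"
  proof
    assume "QuadRes (int r) (int g)"
    then obtain y where y: "[y\<^sup>2 = int g] (mod int r)" by (auto simp: QuadRes_def)
    define x where "x = nat (y mod int r)"
    have x: "int x = y mod int r" using assms(2) by (simp add: x_def)
    have "int (x\<^sup>2 mod r) = (y mod int r)\<^sup>2 mod int r" by (simp add: zmod_int x)
    also have "\<dots> = int g" using y g(1) by (simp add: power_mod cong_def)
    finally have "x\<^sup>2 mod r = g" by simp
    moreover have "x < r" 
    proof -
      have "int x < int r" unfolding x using assms(2) by simp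
      then show ?thesis by simp
    qed
    moreover have "x \<noteq> 0" using \<open>x\<^sup>2 mod r = g\<close> g(1) by (cases "x = 0") auto
    ultimately show False using g(2) by auto
  qed
  ultimately show ?thesis by (auto simp: Legendre_def)
qed

text \<open>Roots modulo the distinct primes are glued by the Chinese remainder theorem.\<close>

lemma square_root_mod_squarefree:
  fixes m :: nat and c :: int
  assumes "m > 0" "squarefree m" "\<And>p. prime p \<Longrightarrow> p dvd m \<Longrightarrow> \<exists>t. [t\<^sup>2 = c] (mod int p)"
  shows "\<exists>t. [t\<^sup>2 = c] (mod int m)"
  using assms
proof (induction m rule: nat_prime_power_induct)
  case one
  then show ?case by simp
next
  case (step p a m)
  have "a = 1"
  proof (rule ccontr)
    assume "a \<noteq> 1"
    then have "p\<^sup>2 dvd p ^ a * m" using step(4) by (intro dvd_mult2 le_imp_power_dvd) auto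
    from squarefreeD[OF step.prems(1) this] show False using step(1) not_prime_unit by blast
  qed
  have "squarefree m" using squarefree_mono[OF _ step.prems(1), of m] by simp
  then obtain t where t: "[t\<^sup>2 = c] (mod int m)" using step.IH step.prems(2) by auto
  obtain u where u: "[u\<^sup>2 = c] (mod int p)" using step.prems(2)[of p] step(1) \<open>a = 1\<close> by auto
  have "coprime p m" using step(1,2) by (simp add: prime_imp_coprime)
  then have cop: "coprime (int p) (int m)" by simp
  obtain x where x: "[x = u] (mod int p)" "[x = t] (mod int m)"
    using binary_chinese_remainder_int[OF cop] by blast
  have "[x\<^sup>2 = c] (mod int p)" "[x\<^sup>2 = c] (mod int m)"
    using cong_trans[OF cong_pow[OF x(1)] u] cong_trans[OF cong_pow[OF x(2)] t] by simp_all
  then have "[x\<^sup>2 = c] (mod int p * int m)"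
    using cop by (simp add: coprime_cong_mult)
  then show ?case using \<open>a = 1\<close> by auto
qed

lemma squarefree_eq_prod_prime_factors:
  fixes n :: nat
  assumes "squarefree n"
  shows "\<Prod>(prime_factors n) = n"
proof -
  have "n \<noteq> 0" using assms by (cases "n = 0") auto
  then have "n = (\<Prod>p\<in>prime_factors n. p ^ multiplicity p n)" by (simp add: prime_factorization_nat)
  also have "\<dots> = \<Prod>(prime_factors n)"
    using assms \<open>n \<noteq> 0\<close> by (intro prod.cong) (auto simp: squarefree_factorial_semiring')
  finally show ?thesis ..
qed

text \<open>For independence, fix \<open>r\<close> in \<open>S\<close> and use the Chinese remainder
  theorem to choose \<open>a\<close> congruent to a nonresidue modulo \<open>r\<close> and to 1
  modulo every other prime factor.\<close>

lemma independent_Legendre: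
  fixes n :: nat
  assumes "squarefree n" "odd n" "n > 1"
  shows "independent_characters (prime_factors n) (\<lambda>r a. of_int (Legendre (int a) (int r))) n"
proof
  have prime: "prime r" "r > 2" "r dvd n" if "r \<in> prime_factors n" for r
  proof -
    show "prime r" "r dvd n" using that by auto
    then show "r > 2"
      using assms(2) prime_gt_1_nat[of r] by (cases "r = 2") auto
  qed
  show "n > 0" using assms by simp
  show "finite (prime_factors n)" by simp
  show "prime_factors n \<noteq> {}" using assms(3) by (simp add: prime_factorization_empty_iff)
  show "of_int (Legendre (int (a * b)) (int r))
      = (of_int (Legendre (int a) (int r)) * of_int (Legendre (int b) (int r)) :: real)"
    if "r \<in> prime_factors n" for r a b
    using Legendre_mult[OF prime(1,2)[OF that]] by simp
  show "of_int (Legendre (int a) (int r)) = (1::real) \<or> of_int (Legendre (int a) (int r)) = (-1::real)"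
    if "r \<in> prime_factors n" "coprime a n" for r a
  proof -
    have "coprime a r" using that(2) prime(3)[OF that(1)] coprime_divisors[of a a r n] by simp
    then show ?thesis using Legendre_coprime[OF prime(1)[OF that(1)]] by fastforce
  qed
  show "of_int (Legendre (int (a + n)) (int r)) = (of_int (Legendre (int a) (int r)) :: real)"
    if "r \<in> prime_factors n" for r a
  proof -
    have "[int (a + n) = int a] (mod int r)"
      using prime(3)[OF that] by (simp add: cong_iff_dvd_diff)
    then show ?thesis using Legendre_cong by simp
  qed
  show "\<exists>a. coprime a n \<and> (\<Prod>r\<in>S. of_int (Legendre (int a) (int r))) = (-1::real)"
    if S: "S \<subseteq> prime_factors n" "S \<noteq> {}" for S
  proof -
    obtain r where r: "r \<in> S" using S(2) by blast
    obtain g where g: "Legendre (int g) (int r) = -1"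
      using exists_nonresidue prime(1,2) r S(1) by blast
    have "\<forall>i\<in>prime_factors n. \<forall>j\<in>prime_factors n. i \<noteq> j \<longrightarrow> coprime i j"
      using prime(1) primes_coprime by blast
    from chinese_remainder_nat[OF _ this, of "\<lambda>i. if i = r then g else 1"]
    obtain a where a: "\<And>i. i \<in> prime_factors n \<Longrightarrow> [a = (if i = r then g else 1)] (mod i)"
      by auto
    have leg: "Legendre (int a) (int i) = (if i = r then -1 else 1)" if i: "i \<in> prime_factors n" for i
    proof -
      have "Legendre (int a) (int i) = Legendre (int (if i = r then g else 1)) (int i)"
        using a[OF i] by (intro Legendre_cong) (simp only: cong_int_iff)
      moreover have "Legendre 1 (int i) = 1"
      proof -
        have "Legendre 1 (int i) = Legendre 1 (int i) * Legendre 1 (int i)"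
          using Legendre_mult[OF prime(1,2)[OF i], of 1 1] by simp
        moreover have "Legendre 1 (int i) \<noteq> 0"
          using Legendre_coprime[OF prime(1)[OF i], of 1] by auto
        ultimately show ?thesis by simp
      qed
      ultimately show ?thesis using g by simp
    qed
    have "coprime a i" if i: "i \<in> prime_factors n" for i
    proof (rule ccontr)
      assume "\<not> coprime a i"
      then have "i dvd a" using prime(1)[OF i] by (metis coprime_commute prime_imp_coprime)
      then have "[int a = 0] (mod int i)" by (simp add: cong_0_iff)
      then have "Legendre (int a) (int i) = 0" by (simp add: Legendre_def)
      then show False using leg[OF i] by (simp split: if_splits)
    qed
    then have "coprime a (\<Prod>(prime_factors n))"
      by (intro prod_coprime_right)
    then have "coprime a n" using squarefree_eq_prod_prime_factors[OF assms(1)] by simp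
    moreover have "(\<Prod>i\<in>S. of_int (Legendre (int a) (int i))) = (\<Prod>i\<in>S. if i = r then -1 else 1 :: real)"
      using S(1) leg by (intro prod.cong) auto
    moreover have "(\<Prod>i\<in>S. if i = r then -1 else 1 :: real) = -1"
      using r finite_subset[OF S(1)] by (simp add: prod.delta)
    ultimately show ?thesis by metis
  qed
qed

lemma sum_three_squares_squarefree:
  fixes n :: nat
  assumes "squarefree n" "n mod 8 = 3"
  shows "\<exists>x y z. int n = x\<^sup>2 + y\<^sup>2 + z\<^sup>2"
proof -
  have "odd n" using assms(2) by presburger
  have "n > 1" using assms(2) by presburger
  define I where "I = prime_factors n"
  have prodI: "\<Prod>I = n" unfolding I_def using assms(1) by (rule squarefree_eq_prod_prime_factors)
  have finI: "finite I" by (simp add: I_def)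
  have I: "prime r \<and> r > 2" if "r \<in> I" for r
  proof -
    have "prime r" "r dvd n" using that by (auto simp: I_def)
    then show ?thesis using \<open>odd n\<close> prime_gt_1_nat[of r] by (cases "r = 2") auto
  qed
  interpret independent_characters I "\<lambda>r a. of_int (Legendre (int a) (int r))" n
    unfolding I_def using assms(1) \<open>odd n\<close> \<open>n > 1\<close> by (rule independent_Legendre)
  \<comment> \<open>This is the compatibility condition on the prescribed signs; it holds because
    \<open>n\<close> is 3 modulo 8.\<close>
  have "(\<Prod>r\<in>I. Legendre (-2) (int r)) = 1"
    using prod_Legendre_minus_two[OF finI I] prodI assms(2) by simp
  then have prod1: "(\<Prod>r\<in>I. of_int (Legendre (-2) (int r)) :: real) = 1"
    by (simp flip: of_int_prod)
  have "of_int (Legendre (-2) (int r)) = (1::real) \<or> of_int (Legendre (-2) (int r)) = (-1::real)"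
    if "r \<in> I" for r
    using Legendre_minus_two[of r] I[OF that] by auto
  then obtain q where q: "q > 0" "coprime q n" "full.divisor_sum q \<noteq> 0"
    "\<And>r. r \<in> I \<Longrightarrow> of_int (Legendre (int q) (int r)) = (of_int (Legendre (-2) (int r)) :: real)"
    using exists_prescribed_characters[of "\<lambda>r. of_int (Legendre (-2) (int r))"] prod1 by blast
  define q0 k where "q0 = squarefree_part q" and "k = square_part q"
  have qk: "q = q0 * k\<^sup>2" unfolding q0_def k_def by (rule squarefree_decompose)
  have q0: "squarefree q0" "q0 > 0"
    unfolding q0_def using squarefree_part_nonzero[of q] by (auto simp del: squarefree_part_nonzero)
  have copn: "coprime q0 n" "coprime k n" using q(2) qk by auto

  \<comment> \<open>A prime factor of \<open>q0\<close> has odd multiplicity in \<open>q\<close>, so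
    the nonzero divisor sum forces \<open>prodchar I p = 1\<close>. This excludes
    \<open>p = 2\<close>, because the Jacobi symbol of 2 modulo \<open>n\<close> is -1. As
    \<open>n\<close> is 3 modulo 4, reciprocity turns it into the Legendre symbol of
    \<open>- n\<close> modulo \<open>p\<close> being 1.\<close>
  have p_mod: "p > 2 \<and> Legendre (- int n) (int p) = 1" if p: "prime p" "p dvd q0" for p
  proof -
    have "multiplicity p q0 > 0" using p q0(2) by (simp add: prime_multiplicity_gt_zero_iff)
    then have odd: "odd (multiplicity p q)"
      unfolding q0_def prime_multiplicity_squarefree_part[OF p(1)] by presburger
    have copp: "coprime p n" using copn(1) p(2) coprime_divisors[of p q0 n n] by simp
    have "prodchar I p \<noteq> -1" using full.divisor_sum_eq_0[OF q(1) p(1) _ odd] q(3) by blast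
    then have "prodchar I p = 1" using prodchar_coprime[of I p] copp by auto
    then have "(\<Prod>r\<in>I. of_int (Legendre (int p) (int r)) :: real) = 1"
      using copp by (simp add: prodchar_def)
    then have prod_p: "(\<Prod>r\<in>I. Legendre (int p) (int r)) = 1"
      by (simp flip: of_int_prod)
    have "p \<noteq> 2"
    proof
      assume "p = 2"
      then show False using prod_p prod_Legendre_two[OF finI I] prodI assms(2) by simp
    qed
    then have "p > 2" using p(1) prime_gt_1_nat[of p] by linarith
    have "p \<notin> I"
      using copp p(1) coprime_common_divisor[of p n p] not_prime_unit by (auto simp: I_def)
    have "n mod 4 = 3" using assms(2) by presburger
    then have "Legendre (int n) (int p) = (if p mod 4 = 1 then 1 else -1)"
      using prod_Legendre_reciprocity[OF finI I p(1) \<open>p > 2\<close> \<open>p \<notin> I\<close>] prod_p prodI by simp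
    moreover have "Legendre (- int n) (int p) = Legendre (-1) (int p) * Legendre (int n) (int p)"
      using Legendre_mult[OF p(1) \<open>p > 2\<close>, of "-1" "int n"] by simp
    ultimately show ?thesis
      using Legendre_minus_one[OF p(1) \<open>p > 2\<close>] \<open>p > 2\<close> by simp
  qed
  define Q where "Q = 2 * q0"
  have "odd q0" using p_mod[of 2] by auto
  then have sqQ: "squarefree Q"
    unfolding Q_def using q0(1) squarefree_prime[OF two_is_prime_nat]
    by (intro squarefree_mult_coprime) auto
  have "Q > 0" using q0(2) by (simp add: Q_def)
  have "\<exists>t. [t\<^sup>2 = - int n] (mod int Q)"
  proof (rule square_root_mod_squarefree[OF \<open>Q > 0\<close> sqQ])
    fix p assume p: "prime p" "p dvd Q"
    show "\<exists>t. [t\<^sup>2 = - int n] (mod int p)"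
    proof (cases "p = 2")
      case True
      have "[1\<^sup>2 = - int n] (mod int 2)" using \<open>odd n\<close> by (simp add: cong_iff_dvd_diff)
      then show ?thesis unfolding True by blast
    next
      case False
      then have "p dvd q0" using p primes_dvd_imp_eq[of p 2] by (auto simp: Q_def prime_dvd_mult_iff)
      then show ?thesis using p_mod[OF p(1)] Legendre_eq_1D by blast
    qed
  qed
  then obtain t where "int Q dvd t\<^sup>2 + int n" by (auto simp: cong_iff_dvd_diff)
  then obtain r where r: "t\<^sup>2 + int n = int Q * r" by (elim dvdE)
  \<comment> \<open>Modulo a prime factor of \<open>n\<close>, the symbol of \<open>q0\<close>
    equals that of \<open>q\<close>, hence that of -2; so \<open>-Q = -2 * q0\<close> has symbol
    1.\<close>
  have "\<exists>s. [s\<^sup>2 = - int Q] (mod int n)"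
  proof (rule square_root_mod_squarefree[OF _ assms(1)])
    fix p assume p: "prime p" "p dvd n"
    then have pI: "p \<in> I" using \<open>n > 1\<close> by (auto simp: I_def prime_factors_dvd)
    then have p2: "p > 2" using I by blast
    have "Legendre (int q) (int p) = Legendre (-2) (int p)" using q(4)[OF pI] by simp
    moreover have "Legendre (int q) (int p) = Legendre (int q0) (int p) * (Legendre (int k) (int p))\<^sup>2"
      unfolding qk using Legendre_mult[OF p(1) p2] by (simp add: power2_eq_square)
    moreover have "(Legendre (int k) (int p))\<^sup>2 = 1"
    proof -
      have "coprime k p" using copn(2) p(2) coprime_divisors[of k k p n] by simp
      then show ?thesis using Legendre_coprime[OF p(1)] by fastforce
    qed
    moreover have "- int Q = (-2) * int q0" by (simp add: Q_def)
    then have "Legendre (- int Q) (int p) = Legendre (-2) (int p) * Legendre (int q0) (int p)"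
      using Legendre_mult[OF p(1) p2, of "-2" "int q0"] by simp
    moreover have "(Legendre (-2) (int p))\<^sup>2 = 1" using Legendre_minus_two[OF p(1) p2] by simp
    ultimately have "Legendre (- int Q) (int p) = 1" by (simp add: power2_eq_square)
    then show "\<exists>s. [s\<^sup>2 = - int Q] (mod int p)" by (rule Legendre_eq_1D)
  qed (use \<open>n > 1\<close> in simp)
  then obtain s where s: "int n dvd s\<^sup>2 + int Q" by (auto simp: cong_iff_dvd_diff)
  have "coprime Q n" using copn(1) \<open>odd n\<close> by (simp add: Q_def)
  then have "coprime (int Q) (int n)" by simp
  then obtain u where u: "[int Q * u = 1] (mod int n)" using cong_solve_coprime_int by blast
  \<comment> \<open>Modulo \<open>n\<close>, \<open>u\<close> is the inverse of \<open>Q\<close> and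
    \<open>s\<^sup>2\<close> is \<open>-Q\<close>, so \<open>Q * (s * u)\<^sup>2\<close> is -1. Thus
    \<open>s * u\<close> serves as the entry \<open>v\<close> of the criterion.\<close>
  have "1 + int Q * (s * u)\<^sup>2 = int Q * u\<^sup>2 * (s\<^sup>2 + int Q) - (int Q * u - 1) * (int Q * u + 1)"
    by (simp add: power2_eq_square algebra_simps)
  moreover have "int n dvd int Q * u\<^sup>2 * (s\<^sup>2 + int Q)" using s by simp
  moreover have "int n dvd (int Q * u - 1) * (int Q * u + 1)" using u by (simp add: cong_iff_dvd_diff)
  ultimately have "int n dvd 1 + int Q * (s * u)\<^sup>2" by simp
  then obtain w where w: "1 + int Q * (s * u)\<^sup>2 = int n * w" by (elim dvdE)
  show ?thesis
    by (rule sum_three_squares_criterion[of "int n" "int Q" r t w "s * u"])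
       (use r w \<open>n > 1\<close> \<open>Q > 0\<close> in \<open>simp_all add: mult.commute\<close>)
qed

text \<open>The square part is odd and its square is 1 modulo 8, so the squarefree part is still 3
  modulo 8; a representation of it is scaled up.\<close>

theorem sum_three_squares_mod_8:
  fixes m :: int
  assumes "m > 0" "m mod 8 = 3"
  shows "\<exists>x y z. m = x\<^sup>2 + y\<^sup>2 + z\<^sup>2"
proof -
  define n where "n = nat m"
  define n0 k where "n0 = squarefree_part n" and "k = square_part n"
  have m: "m = int n" using assms(1) by (simp add: n_def)
  have nk: "n = n0 * k\<^sup>2" unfolding n0_def k_def by (rule squarefree_decompose)
  have "n mod 8 = 3" using assms(2) m by presburger
  then have "odd n" by presburger
  then have "odd k" using nk by simp
  have "k\<^sup>2 mod 8 = 1"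
  proof -
    obtain j where "k = 2 * j + 1" using \<open>odd k\<close> by (elim oddE)
    then have "k\<^sup>2 = 4 * (j * (j + 1)) + 1" by (simp add: power2_eq_square)
    moreover have "even (j * (j + 1))" by simp
    then obtain i where "j * (j + 1) = 2 * i" by (elim evenE)
    ultimately have "k\<^sup>2 = 8 * i + 1" by linarith
    then show ?thesis by simp
  qed
  then have "n mod 8 = n0 mod 8" unfolding nk using mod_mult_right_eq[of n0 "k\<^sup>2" 8] by simp
  then have "\<exists>x y z. int n0 = x\<^sup>2 + y\<^sup>2 + z\<^sup>2"
    using \<open>n mod 8 = 3\<close> by (intro sum_three_squares_squarefree) (auto simp: n0_def)
  then obtain x y z where "int n0 = x\<^sup>2 + y\<^sup>2 + z\<^sup>2" by blast
  then have "m = (k * x)\<^sup>2 + (k * y)\<^sup>2 + (k * z)\<^sup>2"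
    unfolding m nk by (simp add: power_mult_distrib algebra_simps)
  then show ?thesis by blast
qed

section \<open>Cauchy's lemma and the small cases\<close>

text \<open>Writing \<open>4 * a - b\<^sup>2\<close> as a sum of three squares of odd
  \<open>x\<close>, \<open>y\<close>, \<open>z\<close>, the solution consists of the quarters of
  \<open>b + x + y + z\<close>, \<open>b + x - y - z\<close>, \<open>b - x + y - z\<close> and
  \<open>b - x - y + z\<close>. The last hypothesis is what makes them nonnegative.\<close>

lemma cauchy_lemma:
  fixes a b :: int
  assumes "odd a" "odd b" "b > 0" "b\<^sup>2 < 4 * a" "3 * a < b\<^sup>2 + 2 * b + 4"
  shows "\<exists>s t u v :: int. s \<ge> 0 \<and> t \<ge> 0 \<and> u \<ge> 0 \<and> v \<ge> 0 \<and>
           a = s\<^sup>2 + t\<^sup>2 + u\<^sup>2 + v\<^sup>2 \<and> b = s + t + u + v"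
proof -
  define m where "m = 4 * a - b\<^sup>2"
  have sq8: "x\<^sup>2 mod 8 = (if odd x then 1 else if x mod 4 = 0 then 0 else 4)" for x :: int
  proof -
    have "x mod 8 \<in> {0..7}" by simp
    then have "x mod 8 \<in> {0,1,2,3,4,5,6,7}" by auto
    moreover have "x\<^sup>2 mod 8 = (x mod 8)\<^sup>2 mod 8" by (simp add: power_mod)
    moreover have "odd x \<longleftrightarrow> odd (x mod 8)" by presburger
    moreover have "x mod 4 = x mod 8 mod 4" by (simp add: mod_mod_cancel)
    ultimately show ?thesis by auto
  qed
  have "m mod 8 = 3"
  proof -
    have "b\<^sup>2 mod 8 = 1" using sq8 \<open>odd b\<close> by simp
    then show ?thesis unfolding m_def using \<open>odd a\<close> by presburger
  qed
  moreover have "m > 0" using assms(4) by (simp add: m_def)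
  ultimately obtain x0 y0 z0 where xyz0: "m = x0\<^sup>2 + y0\<^sup>2 + z0\<^sup>2" using sum_three_squares_mod_8 by blast
  have "odd x0 \<and> odd y0 \<and> odd z0"
  proof -
    have "(x0\<^sup>2 + y0\<^sup>2 + z0\<^sup>2) mod 8 = 3" using \<open>m mod 8 = 3\<close> xyz0 by simp
    then have "(x0\<^sup>2 mod 8 + y0\<^sup>2 mod 8 + z0\<^sup>2 mod 8) mod 8 = 3" by presburger
    then show ?thesis by (auto simp: sq8 split: if_splits)
  qed
  define x y where "x = \<bar>x0\<bar>" and "y = \<bar>y0\<bar>"
  \<comment> \<open>The two candidates for the sum are even and differ by \<open>2 * z0\<close>,
    which is 2 modulo 4; hence one of them is divisible by 4.\<close>
  define z where "z = (if 4 dvd b + x + y + z0 then z0 else - z0)"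
  have odds: "odd x" "odd y" "odd z" and pos: "x \<ge> 0" "y \<ge> 0"
    using \<open>odd x0 \<and> odd y0 \<and> odd z0\<close> by (auto simp: x_def y_def z_def)
  have xyz: "m = x\<^sup>2 + y\<^sup>2 + z\<^sup>2" using xyz0 by (simp add: x_def y_def z_def)
  have "4 dvd b + x + y + z"
    unfolding z_def using \<open>odd b\<close> odds(1,2) \<open>odd x0 \<and> odd y0 \<and> odd z0\<close> by presburger
  then obtain s where s: "b + x + y + z = 4 * s" by (elim dvdE)
  obtain j where j: "y + z = 2 * j" using odds by (meson dvdE odd_even_add)
  obtain k where k: "x + z = 2 * k" using odds by (meson dvdE odd_even_add)
  obtain l where l: "x + y = 2 * l" using odds by (meson dvdE odd_even_add)
  define t u v where "t = s - j" and "u = s - k" and "v = s - l"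
  have t: "b + x - y - z = 4 * t" and u: "b - x + y - z = 4 * u" and v: "b - x - y + z = 4 * v"
    using s j k l by (auto simp: t_def u_def v_def)
  \<comment> \<open>By Cauchy-Schwarz the square of the left side is at most \<open>3 * m\<close>.
    The strict bound makes each of the four integers greater than -1.\<close>
  have "x + y + \<bar>z\<bar> < b + 4"
  proof (rule ccontr)
    assume "\<not> ?thesis"
    then have "(b + 4)\<^sup>2 \<le> (x + y + \<bar>z\<bar>)\<^sup>2" using \<open>b > 0\<close> by (intro power_mono) auto
    also have "\<dots> \<le> 3 * (x\<^sup>2 + y\<^sup>2 + \<bar>z\<bar>\<^sup>2)"
      using zero_le_power2[of "x - y"] zero_le_power2[of "x - \<bar>z\<bar>"] zero_le_power2[of "y - \<bar>z\<bar>"]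
      by (simp add: power2_eq_square algebra_simps)
    also have "\<dots> = 12 * a - 3 * b\<^sup>2" using xyz by (simp add: m_def)
    finally show False using assms(5) by (simp add: power2_eq_square algebra_simps)
  qed
  then have nonneg: "s \<ge> 0" "t \<ge> 0" "u \<ge> 0" "v \<ge> 0"
    using s t u v pos by linarith+
  have "16 * (s\<^sup>2 + t\<^sup>2 + u\<^sup>2 + v\<^sup>2) = (4 * s)\<^sup>2 + (4 * t)\<^sup>2 + (4 * u)\<^sup>2 + (4 * v)\<^sup>2"
    by (simp add: power2_eq_square algebra_simps)
  also have "\<dots> = 4 * (b\<^sup>2 + (x\<^sup>2 + y\<^sup>2 + z\<^sup>2))"
    unfolding s[symmetric] t[symmetric] u[symmetric] v[symmetric]
    by (simp add: power2_eq_square algebra_simps)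
  also have "\<dots> = 16 * a" using xyz by (simp add: m_def)
  finally have "a = s\<^sup>2 + t\<^sup>2 + u\<^sup>2 + v\<^sup>2" by simp
  moreover have "b = s + t + u + v" using s t u v by linarith
  ultimately show ?thesis using nonneg by blast
qed

section \<open>Large n by Cauchy's lemma\<close>

text \<open>The values \<open>c = 1\<close> and \<open>c = -1\<close> give the two families of the
  theorem; negating \<open>w\<close> exchanges them.\<close>

definition pent :: "int \<Rightarrow> int \<Rightarrow> int" where
  "pent c w = w * (5 * w + c) div 2"

lemma two_pent: "odd c \<Longrightarrow> 2 * pent c w = 5 * w\<^sup>2 + c * w"
  unfolding pent_def by (subst even_two_times_div_two) (simp_all add: power2_eq_square algebra_simps)

definition sum4 :: "int \<Rightarrow> int \<Rightarrow> bool" where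
  "sum4 c n \<longleftrightarrow> (\<exists>w x y z. n = pent c (int w) + pent c (int x) + pent c (int y) + pent c (int z))"

lemma sum4I:
  assumes "odd c" "s \<ge> 0" "t \<ge> 0" "u \<ge> 0" "v \<ge> 0"
    and "2 * n = 5 * (s\<^sup>2 + t\<^sup>2 + u\<^sup>2 + v\<^sup>2) + c * (s + t + u + v)"
  shows "sum4 c n"
proof -
  have "2 * n = 2 * (pent c s + pent c t + pent c u + pent c v)"
    using assms(1,6) by (simp add: two_pent algebra_simps)
  then have "n = pent c (int (nat s)) + pent c (int (nat t)) + pent c (int (nat u)) + pent c (int (nat v))"
    using assms(2-5) by simp
  then show ?thesis unfolding sum4_def by blast
qed

text \<open>For \<open>5 * a = 2 * n - c * b\<close> the inequalities of Cauchy's lemma read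
  \<open>5 * b\<^sup>2 + 4 * c * b < 8 * n\<close> and
  \<open>6 * n < 5 * b\<^sup>2 + (10 + 3 * c) * b + 20\<close>; the version here implies both for
  either sign \<open>c\<close>. Starting from the least number satisfying the second inequality, at
  most 9 steps reach the required residue class.\<close>

lemma exists_cauchy_parameter:
  fixes n r :: int
  assumes "n \<ge> 3279"
  shows "\<exists>b. b > 0 \<and> b mod 10 = r mod 10 \<and> 5 * b\<^sup>2 + 4 * b < 8 * n \<and> 6 * n < 5 * b\<^sup>2 + 7 * b + 20"
proof -
  let ?P = "\<lambda>c::nat. 6 * n < 5 * (int c)\<^sup>2 + 7 * int c + 20"
  define c where "c = (LEAST c. ?P c)"
  have "?P (nat n)" using assms by (simp add: power2_eq_square) (smt (verit) mult_nonneg_nonneg)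
  then have c: "?P c" unfolding c_def by (rule LeastI)
  \<comment> \<open>The threshold comes from \<open>6 * 3279 = 5 * 62\<^sup>2 + 7 * 62 + 20\<close>,
    so 62 fails. From 63 on, an increase by 9 still respects the first inequality.\<close>
  have "c \<ge> 63"
  proof (rule ccontr)
    assume "\<not> c \<ge> 63"
    then have "int c \<le> 62" by simp
    then have "(int c)\<^sup>2 \<le> 62\<^sup>2" by (intro power_mono) auto
    then show False using c \<open>int c \<le> 62\<close> assms by simp
  qed
  then have "\<not> ?P (c - 1)" unfolding c_def by (intro not_less_Least) auto
  moreover have "int (c - 1) = int c - 1" using \<open>c \<ge> 63\<close> by simp
  ultimately have up: "6 * n \<ge> 5 * (int c)\<^sup>2 - 3 * int c + 18"
    by (simp add: power2_eq_square algebra_simps)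
  define b where "b = int c + (r - int c) mod 10"
  have b: "int c \<le> b" "b \<le> int c + 9" unfolding b_def
    using pos_mod_bound[of 10 "r - int c"] by simp_all
  have "(int c)\<^sup>2 \<le> b\<^sup>2" using b by (intro power_mono) auto
  then have 1: "6 * n < 5 * b\<^sup>2 + 7 * b + 20" using c b by linarith
  have "b\<^sup>2 \<le> (int c + 9)\<^sup>2" using b \<open>c \<ge> 63\<close> by (intro power_mono) auto
  then have "b\<^sup>2 \<le> (int c)\<^sup>2 + 18 * int c + 81" by (simp add: power2_eq_square algebra_simps)
  moreover have "63 * int c \<le> (int c)\<^sup>2" unfolding power2_eq_square using \<open>c \<ge> 63\<close> by (intro mult_right_mono) auto
  ultimately have 2: "5 * b\<^sup>2 + 4 * b < 8 * n" using up b(2) \<open>c \<ge> 63\<close> by linarith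
  have "b mod 10 = r mod 10" unfolding b_def by (simp add: mod_simps)
  then show ?thesis using 1 2 b \<open>c \<ge> 63\<close> by (intro exI[of _ b]) auto
qed

lemma sum4_large:
  assumes "n \<ge> 3279" "c = 1 \<or> c = -1"
  shows "sum4 c n"
proof -
  \<comment> \<open>The residue makes \<open>b\<close> odd and congruent to \<open>2 * c * n\<close>
    modulo 5; as the square of \<open>c\<close> is 1, 5 divides
    \<open>2 * n - c * b\<close>.\<close>
  obtain b where b: "b > 0" "b mod 10 = (5 + 2 * c * n) mod 10"
      "5 * b\<^sup>2 + 4 * b < 8 * n" "6 * n < 5 * b\<^sup>2 + 7 * b + 20"
    using exists_cauchy_parameter[OF assms(1)] by blast
  have "odd b \<and> 5 dvd 2 * n - c * b"
    using assms(2)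
  proof
    assume "c = 1"
    then have "b mod 10 = (5 + 2 * n) mod 10" using b(2) by simp
    then have "odd b \<and> 5 dvd 2 * n - b" by presburger
    then show ?thesis using \<open>c = 1\<close> by simp
  next
    assume "c = -1"
    then have "b mod 10 = (5 - 2 * n) mod 10" using b(2) by simp
    then have "odd b \<and> 5 dvd 2 * n + b" by presburger
    then show ?thesis using \<open>c = -1\<close> by simp
  qed
  then have "odd b" and "5 dvd 2 * n - c * b" by simp_all
  then obtain a where a: "2 * n - c * b = 5 * a" by (elim dvdE)
  have "odd (5 * a)" unfolding a[symmetric] using \<open>odd b\<close> assms(2) by auto
  then have "odd a" by simp
  have "b\<^sup>2 < 4 * a" "3 * a < b\<^sup>2 + 2 * b + 4" using a b assms(2) by auto
  from cauchy_lemma[OF \<open>odd a\<close> \<open>odd b\<close> b(1) this]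
  obtain s t u v where *: "s \<ge> 0" "t \<ge> 0" "u \<ge> 0" "v \<ge> 0"
    "a = s\<^sup>2 + t\<^sup>2 + u\<^sup>2 + v\<^sup>2" "b = s + t + u + v" by blast
  have "2 * n = 5 * (s\<^sup>2 + t\<^sup>2 + u\<^sup>2 + v\<^sup>2) + c * (s + t + u + v)"
    using a unfolding *(5,6) by simp
  from sum4I[OF _ *(1-4) this] show ?thesis using assms(2) by auto
qed

section \<open>Small n by computed sumsets\<close>

fun or_list :: "bool list \<Rightarrow> bool list \<Rightarrow> bool list" where
  "or_list [] ys = ys"
| "or_list (x # xs) [] = x # xs"
| "or_list (x # xs) (y # ys) = (x \<or> y) # or_list xs ys"

text \<open>Boolean lists are indicators of sets of natural numbers; \<open>sumset A ds\<close> is the union of the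
  translates of \<open>A\<close> by the partial sums of \<open>ds\<close>.\<close>

fun sumset :: "bool list \<Rightarrow> nat list \<Rightarrow> bool list" where
  "sumset A [] = A"
| "sumset A (d # ds) = or_list A (replicate d False @ sumset A ds)"

text \<open>Successive differences of \<open>pent c\<close> at natural arguments, with
  \<open>c = 2 * e - 5\<close>: \<open>e = 3\<close> means \<open>c = 1\<close>, and
  \<open>e = 2\<close> means \<open>c = -1\<close>.\<close>

definition pent_gaps :: "nat \<Rightarrow> nat \<Rightarrow> nat list" where
  "pent_gaps e K = map (\<lambda>j. 5 * j + e) [0..<K]"

lemma length_or_list [simp]: "length (or_list xs ys) = max (length xs) (length ys)"
  by (induction xs ys rule: or_list.induct) auto

lemma nth_or_listD:
  "i < length (or_list xs ys) \<Longrightarrow> or_list xs ys ! i \<Longrightarrow>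
    (i < length xs \<and> xs ! i) \<or> (i < length ys \<and> ys ! i)"
proof (induction xs ys arbitrary: i rule: or_list.induct)
  case (3 x xs y ys)
  then show ?case by (cases i) auto
qed auto

lemma nth_sumsetD:
  "i < length (sumset A ds) \<Longrightarrow> sumset A ds ! i \<Longrightarrow>
    \<exists>k\<le>length ds. \<exists>j<length A. A ! j \<and> i = sum_list (take k ds) + j"
proof (induction ds arbitrary: i)
  case (Cons d ds)
  from nth_or_listD[of i A "replicate d False @ sumset A ds"] Cons.prems
  consider "i < length A" "A ! i" | "i \<ge> d" "i - d < length (sumset A ds)" "sumset A ds ! (i - d)"
    by (auto simp: nth_append split: if_splits)
  then show ?case
  proof cases
    case 1
    then show ?thesis by (intro exI[of _ 0]) simp
  next
    case 2
    then obtain k j where "k \<le> length ds" "j < length A" "A ! j" "i - d = sum_list (take k ds) + j"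
      using Cons.IH[of "i - d"] by blast
    then show ?thesis using \<open>i \<ge> d\<close> by (intro exI[of _ "Suc k"]) auto
  qed
qed auto

lemma sum_pent_gaps:
  assumes "k \<le> K" "c = 2 * int e - 5"
  shows "int (sum_list (take k (pent_gaps e K))) = pent c (int k)"
proof -
  have "2 * int (\<Sum>j<k. 5 * j + e) = 5 * (int k)\<^sup>2 + c * int k" for k
    unfolding assms(2) by (induction k) (auto simp: power2_eq_square algebra_simps)
  moreover have "take k (pent_gaps e K) = map (\<lambda>j. 5 * j + e) [0..<k]"
    using assms(1) by (simp add: pent_gaps_def take_map)
  then have "sum_list (take k (pent_gaps e K)) = (\<Sum>j<k. 5 * j + e)"
    by (simp add: interv_sum_list_conv_sum_set_nat atLeast0LessThan)
  ultimately have "2 * int (sum_list (take k (pent_gaps e K))) = 2 * pent c k"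
    using assms(2) by (simp add: two_pent)
  then show ?thesis by simp
qed

lemma nth_sumset_pentD:
  assumes "i < length (sumset A (pent_gaps e K))" "sumset A (pent_gaps e K) ! i"
  shows "\<exists>w j. j < length A \<and> A ! j \<and> int i = pent (2 * int e - 5) (int w) + int j"
proof -
  obtain k j where k: "k \<le> K" "j < length A" "A ! j" "i = sum_list (take k (pent_gaps e K)) + j"
    using nth_sumsetD[OF assms] by (auto simp: pent_gaps_def)
  then show ?thesis using sum_pent_gaps[OF k(1) refl, of e] by auto
qed

text \<open>Starting from the set containing only 0, each pair \<open>(e, K)\<close> adds one
  variable ranging from 0 to \<open>K\<close>.\<close>

definition pent_table :: "(nat \<times> nat) list \<Rightarrow> bool list" where
  "pent_table ps = foldl (\<lambda>A (e, K). sumset A (pent_gaps e K)) [True] ps"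

text \<open>Conjoining neighbours does not change the truth of \<^term>\<open>list_all (\<lambda>x. x)\<close>. It only serves to
  evaluate this predicate on a long list by rewriting, which is slow when done directly.\<close>

fun halve :: "bool list \<Rightarrow> bool list" where
  "halve [] = []"
| "halve [x] = [x]"
| "halve (x # y # zs) = (x \<and> y) # halve zs"

lemma list_all_halve: "list_all (\<lambda>x. x) (halve xs) = list_all (\<lambda>x. x) xs"
  by (induction xs rule: halve.induct) auto

lemma list_all_funpow_halve: "list_all (\<lambda>x. x) ((halve ^^ j) xs) = list_all (\<lambda>x. x) xs"
  by (induction j) (simp_all add: list_all_halve)

text \<open>The final segment of the mask hides the entries of \<open>T\<close> from position \<open>m + k\<close> on.\<close>

definition covers :: "nat \<Rightarrow> nat \<Rightarrow> bool list \<Rightarrow> bool" where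
  "covers m k T \<longleftrightarrow> list_all (\<lambda>x. x) ((halve ^^ 9)
    (or_list (replicate m True @ replicate k False @ replicate 1100 True) T))"

lemma coversD:
  assumes "covers m k T" "m \<le> i" "i < m + k"
  shows "i < length T" "T ! i"
proof -
  let ?M = "replicate m True @ replicate k False @ replicate 1100 True"
  have "i < length (or_list ?M T)" using assms(3) by simp
  moreover have "list_all (\<lambda>x. x) (or_list ?M T)"
    using assms(1) unfolding covers_def list_all_funpow_halve .
  then have "or_list ?M T ! i" using calculation unfolding list_all_length by blast
  ultimately have "(i < length ?M \<and> ?M ! i) \<or> (i < length T \<and> T ! i)"
    by (rule nth_or_listD)
  moreover have "\<not> ?M ! i" using assms(2,3) by (simp add: nth_append)
  ultimately show "i < length T" "T ! i" by blast+
qed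

lemma pent_tableD:
  assumes "covers m k (pent_table [(e1, K1), (e2, K2), (e3, K3), (e4, K4)])"
    and "m \<le> i" "i < m + k"
  shows "\<exists>w x y z. int i = pent (2 * int e1 - 5) (int w) + pent (2 * int e2 - 5) (int x)
    + pent (2 * int e3 - 5) (int y) + pent (2 * int e4 - 5) (int z)"
proof -
  define A1 A2 A3 where "A1 = sumset [True] (pent_gaps e1 K1)"
    and "A2 = sumset A1 (pent_gaps e2 K2)" and "A3 = sumset A2 (pent_gaps e3 K3)"
  have "pent_table [(e1, K1), (e2, K2), (e3, K3), (e4, K4)] = sumset A3 (pent_gaps e4 K4)"
    by (simp add: pent_table_def A1_def A2_def A3_def)
  then obtain z i3 where 3: "i3 < length A3" "A3 ! i3"
      "int i = pent (2 * int e4 - 5) (int z) + int i3"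
    using nth_sumset_pentD coversD[OF assms] by metis
  obtain y i2 where 2: "i2 < length A2" "A2 ! i2"
      "int i3 = pent (2 * int e3 - 5) (int y) + int i2"
    using nth_sumset_pentD 3(1,2) unfolding A3_def by metis
  obtain x i1 where 1: "i1 < length A1" "A1 ! i1"
      "int i2 = pent (2 * int e2 - 5) (int x) + int i1"
    using nth_sumset_pentD 2(1,2) unfolding A2_def by metis
  obtain w i0 where 0: "i0 < length [True]"
      "int i1 = pent (2 * int e1 - 5) (int w) + int i0"
    using nth_sumset_pentD 1(1,2) unfolding A1_def by metis
  have "int i = pent (2 * int e1 - 5) (int w) + pent (2 * int e2 - 5) (int x)
    + pent (2 * int e3 - 5) (int y) + pent (2 * int e4 - 5) (int z)" using 0 1 2 3 by simp
  then show ?thesis by blast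
qed

text \<open>The 2503 integers from 776 on end just before 3279, where \<open>sum4_large\<close>
  takes over; the other family has \<open>884 + 2395 = 3279\<close>.\<close>

lemma pent_table_plus: "covers 776 2503 (pent_table [(3, 8), (3, 12), (3, 17), (3, 34)])"
  by code_simp

lemma pent_table_minus: "covers 884 2395 (pent_table [(2, 6), (2, 12), (2, 18), (2, 35)])"
  by code_simp

text \<open>Two variables with \<open>c = 1\<close> and two with \<open>c = -1\<close> amount to two
  nonnegative and two nonpositive integers in the first family.\<close>

lemma pent_table_mixed: "covers 20 756 (pent_table [(3, 7), (3, 16), (2, 6), (2, 7)])"
  by code_simp

lemma pent_table_mixed_small: "covers 2 17 (pent_table [(3, 1), (3, 2), (2, 1), (2, 2)])"
  by code_simp

lemma sum4_plus:
  assumes "n \<ge> 776"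
  shows "sum4 1 n"
proof (cases "n \<ge> 3279")
  case False
  then show ?thesis
    using pent_tableD[OF pent_table_plus, of "nat n"] assms by (simp add: sum4_def)
qed (use sum4_large in blast)

lemma sum4_minus:
  assumes "n \<ge> 884"
  shows "sum4 (-1) n"
proof (cases "n \<ge> 3279")
  case False
  then show ?thesis
    using pent_tableD[OF pent_table_minus, of "nat n"] assms by (simp add: sum4_def)
qed (use sum4_large in blast)

lemma pent_uminus: "pent c (- w) = pent (- c) w"
  by (simp add: pent_def algebra_simps)

lemma sum4_int:
  assumes "n > 1"
  shows "\<exists>w x y z. n = pent 1 w + pent 1 x + pent 1 y + pent 1 z"
proof -
  consider "n \<ge> 776" | "20 \<le> n" "n < 776" | "n = 19" | "2 \<le> n" "n < 19"
    using assms by linarith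
  then show ?thesis
  proof cases
    case 1
    then show ?thesis using sum4_plus unfolding sum4_def by blast
  next
    case 2
    then have "\<exists>w x y z. n = pent 1 (int w) + pent 1 (int x) + pent (-1) (int y) + pent (-1) (int z)"
      using pent_tableD[OF pent_table_mixed, of "nat n"] by simp
    then show ?thesis by (metis pent_uminus)
  next
    \<comment> \<open>The number 19 is not reached with two nonnegative and two nonpositive
      arguments; it is \<open>11 + 3 + 3 + 2\<close>.\<close>
    case 3
    then show ?thesis
      by (intro exI[of _ 2] exI[of _ 1] exI[of _ 1] exI[of _ "-1"]) (simp add: pent_def)
  next
    case 4
    then have "\<exists>w x y z. n = pent 1 (int w) + pent 1 (int x) + pent (-1) (int y) + pent (-1) (int z)"
      using pent_tableD[OF pent_table_mixed_small, of "nat n"] by simp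
    then show ?thesis by (metis pent_uminus)
  qed
qed

theorem corollary2:
  shows "(\<forall>n::int. n > 1 \<longrightarrow>
           (\<exists>w x y z :: int.
              n = w * (5 * w + 1) div 2 + x * (5 * x + 1) div 2
                + y * (5 * y + 1) div 2 + z * (5 * z + 1) div 2)) \<and>
         (\<forall>n::int. n \<ge> 776 \<longrightarrow>
           (\<exists>w x y z :: nat.
              n = int w * (5 * int w + 1) div 2 + int x * (5 * int x + 1) div 2
                + int y * (5 * int y + 1) div 2 + int z * (5 * int z + 1) div 2)) \<and>
         (\<forall>n::int. n \<ge> 884 \<longrightarrow>
           (\<exists>w x y z :: nat.
              n = int w * (5 * int w - 1) div 2 + int x * (5 * int x - 1) div 2
                + int y * (5 * int y - 1) div 2 + int z * (5 * int z - 1) div 2))"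
  using sum4_int sum4_plus sum4_minus by (simp add: sum4_def pent_def)

end
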